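(* Let $H, H_1, H_2, \ldots$ be i.i.d. random variables with values in $(0,+\infty]$, set $H_0=+\infty$, and let $(\mathcal P_i)_{i\ge 0}$ be independent Poisson point processes on $(0,\infty)$ with intensity $\theta>0$, independent of $(H_i)$. Let $S_n$ be the number of polymorphic sites in the sample $\{0,1,\ldots,n-1\}$ (defined in the context). If $\mathbb E(H)<\infty$, then $$\lim_{n\to\infty} n^{-1}S_n=\theta\,\mathbb E(H)\quad\text{a.s. and in } L^1.$$ If in addition $\mathbb E(H^2)<\infty$, then $\sqrt n\,(n^{-1}S_n-\theta\,\mathbb E(H))$ converges in distribution to a centered normal random variable with variance $\theta\,\mathbb E(H)+\theta^2\mathrm{Var}(H)$.
   Context: Coalescent point process with mutations: the population is $\{0,1,2,\ldots\}$, the coalescence time between individuals $i<i+k$ is $\max\{H_{i+1},\ldots,H_{i+k}\}$. Denote the atoms of $\mathcal P_i$ by $\ell_{i1}<\ell_{i2}<\cdots$ (mutations). Individual $i+k$ ($k\ge 0$) carries mutation $\ell_{ij}$ iff $\max\{H_{i+1},\ldots,H_{i+k}\}<\ell_{ij}<H_i$, with $\max\emptyset=0$. The sample of size $n$ is $\{0,\ldots,n-1\}$. $S_n$ is the number of mutations carried by at least one and at most $n-1$ individuals of the sample; explicitly $S_n=\mathrm{Card}\{(i,j):1\le i\le n-1,\, j\ge1,\, \ell_{ij}<H_i\}+\mathrm{Card}\{j\ge 1:\ell_{0j}<\max\{H_1,\ldots,H_{n-1}\}\}$. *)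

theory Defs
  imports "HOL-Probability.Probability"
begin

definition pp_count :: "(nat \<Rightarrow> real) \<Rightarrow> real set \<Rightarrow> nat" where
  "pp_count l B = card {j. l j \<in> B}"

text \<open>A (version of a) Poisson point process on (0,infinity) with intensity theta,
  given by its increasingly enumerated atoms l 0 < l 1 < ... (tending to infinity):
  counts in bounded Borel sets are Poisson with mean theta * Lebesgue measure,
  and counts in finitely many pairwise disjoint bounded Borel sets are independent.\<close>
definition poisson_pp :: "'a measure \<Rightarrow> real \<Rightarrow> (nat \<Rightarrow> 'a \<Rightarrow> real) \<Rightarrow> bool" where
  "poisson_pp M \<theta> l \<longleftrightarrow>
     (\<forall>j. l j \<in> borel_measurable M) \<and>
     (\<forall>\<omega>\<in>space M. 0 < l 0 \<omega> \<and> strict_mono (\<lambda>j. l j \<omega>) \<and>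
                   filterlim (\<lambda>j. l j \<omega>) at_top sequentially) \<and>
     (\<forall>B k. B \<in> sets borel \<longrightarrow> B \<subseteq> {0<..} \<longrightarrow> bounded B \<longrightarrow>
        prob_space.prob M {\<omega>\<in>space M. pp_count (\<lambda>j. l j \<omega>) B = k}
          = exp (- (\<theta> * measure lborel B)) * (\<theta> * measure lborel B) ^ k / fact k) \<and>
     (\<forall>F. finite F \<longrightarrow> F \<subseteq> sets borel \<longrightarrow> (\<forall>B\<in>F. B \<subseteq> {0<..} \<and> bounded B) \<longrightarrow>
        disjoint_family_on id F \<longrightarrow>
        prob_space.indep_vars M (\<lambda>_. count_space UNIV)
          (\<lambda>B \<omega>. pp_count (\<lambda>j. l j \<omega>) B) F)"

text \<open>Number of polymorphic sites S_n in the sample {0,...,n-1}; the atoms of P_i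
  are l i 0 < l i 1 < ...; the maximum of the empty family is 0.\<close>
definition seg_sites ::
  "(nat \<Rightarrow> 'a \<Rightarrow> ennreal) \<Rightarrow> (nat \<Rightarrow> nat \<Rightarrow> 'a \<Rightarrow> real) \<Rightarrow> nat \<Rightarrow> 'a \<Rightarrow> nat" where
  "seg_sites H l n \<omega> =
     card {(i, j). 1 \<le> i \<and> i \<le> n - 1 \<and> ennreal (l i j \<omega>) < H i \<omega>}
   + card {j. ennreal (l 0 j \<omega>) < Max (insert 0 ((\<lambda>k. H k \<omega>) ` {1..<n}))}"

end

theory Submission
  imports Defs
begin

text \<open>
  Write \<open>N\<^sub>k\<^sub>i\<close> for the number of atoms of \<open>P\<^sub>k\<close> below \<open>H\<^sub>i\<close>. Almost surely
  \<open>S\<^sub>n = N\<^sub>1\<^sub>1 + \<dots> + N\<^sub>n\<^sub>-\<^sub>1\<^sub>,\<^sub>n\<^sub>-\<^sub>1 + R\<^sub>n\<close> with \<open>R\<^sub>n = max {N\<^sub>0\<^sub>i | 1 \<le> i < n}\<close>. Each \<open>N\<^sub>k\<^sub>i\<close> is mixed Poisson with a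
  law that depends only on the law of \<open>H\<close>, so the diagonal terms are i.i.d. with mean \<open>\<theta> E(H)\<close> and
  variance \<open>\<theta> E(H) + \<theta>\<^sup>2 Var(H)\<close>, and the strong law and the central limit theorem apply to their sum.
  The variables \<open>N\<^sub>0\<^sub>i\<close> are dependent but identically distributed, which is enough for Borel--Cantelli
  to make \<open>R\<^sub>n\<close> of order \<open>o(n)\<close>, and \<open>o(\<surd>n)\<close> under a second moment. Convergence in \<open>L\<^sup>1\<close> follows by
  Scheffe's lemma from the convergence of the means.

  The strong law is obtained from the fact that the partial sums of i.i.d. variables with negative
  mean are bounded above (Garsia's maximal argument and Kolmogorov's 0-1 law).
\<close>

section \<open>The strong law of large numbers\<close>

text \<open>The maximum of \<open>0\<close> and the first \<open>n\<close> partial sums, unfolded at the front so that the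
  shifted sequence appears on the right-hand side.\<close>

primrec max_psum :: "nat \<Rightarrow> (nat \<Rightarrow> real) \<Rightarrow> real" where
  "max_psum 0 x = 0"
| "max_psum (Suc n) x = max 0 (x 0 + max_psum n (\<lambda>i. x (Suc i)))"

lemma max_psum_nonneg: "0 \<le> max_psum n x"
  by (cases n) auto

lemma max_psum_mono_Suc: "max_psum n x \<le> max_psum (Suc n) x"
proof (induction n arbitrary: x)
  case (Suc n)
  have "max_psum n (\<lambda>i. x (Suc i)) \<le> max_psum (Suc n) (\<lambda>i. x (Suc i))" by (rule Suc)
  then show ?case by (simp only: max_psum.simps)
qed simp

lemma sum_le_max_psum: "(\<Sum>i<n. x i) \<le> max_psum n x"
proof (induction n arbitrary: x)
  case (Suc n)
  have "(\<Sum>i<n. x (Suc i)) \<le> max_psum n (\<lambda>i. x (Suc i))" by (rule Suc)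
  then show ?case by (simp add: sum.lessThan_Suc_shift del: sum.lessThan_Suc)
qed simp

lemma measurable_max_psum [measurable]: "max_psum n \<in> borel_measurable (Pi\<^sub>M UNIV (\<lambda>_. borel))"
proof (induction n)
  case (Suc n)
  note [measurable] = Suc
  have [measurable]: "(\<lambda>x i. x (Suc i)) \<in> Pi\<^sub>M UNIV (\<lambda>_. borel) \<rightarrow>\<^sub>M Pi\<^sub>M UNIV (\<lambda>_. (borel :: real measure))"
    by (rule measurable_PiM_single') (auto simp: space_PiM)
  show ?case unfolding max_psum.simps by measurable
qed (simp add: max_psum.simps)

lemma bdd_above_shifted_sums_iff:
  fixes x :: "nat \<Rightarrow> real"
  shows "bdd_above (range (\<lambda>n. \<Sum>i<n. x (m + i))) \<longleftrightarrow> bdd_above (range (\<lambda>n. \<Sum>i<n. x i))"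
proof -
  have split: "(\<Sum>i<m + n. x i) = (\<Sum>i<m. x i) + (\<Sum>i<n. x (m + i))" for n
    by (induction n) auto
  show ?thesis
  proof
    assume "bdd_above (range (\<lambda>n. \<Sum>i<n. x (m + i)))"
    then obtain c where c: "\<And>n. (\<Sum>i<n. x (m + i)) \<le> c" by (auto simp: bdd_above_def)
    have "(\<Sum>i<n. x i) \<le> max ((\<Sum>i<m. x i) + c) (Max ((\<lambda>n. \<Sum>i<n. x i) ` {..m}))" for n
    proof (cases "n \<le> m")
      case True
      then have "(\<Sum>i<n. x i) \<le> Max ((\<lambda>n. \<Sum>i<n. x i) ` {..m})" by (intro Max_ge) auto
      then show ?thesis by simp
    next
      case False
      then have "n = m + (n - m)" by simp
      then show ?thesis using c[of "n - m"] split[of "n - m"] by (simp add: le_max_iff_disj)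
    qed
    then show "bdd_above (range (\<lambda>n. \<Sum>i<n. x i))" by (auto simp: bdd_above_def)
  next
    assume "bdd_above (range (\<lambda>n. \<Sum>i<n. x i))"
    then obtain c where c: "\<And>n. (\<Sum>i<n. x i) \<le> c" by (auto simp: bdd_above_def)
    have "(\<Sum>i<n. x (m + i)) \<le> c - (\<Sum>i<m. x i)" for n
      using c[of "m + n"] split[of n] by simp
    then show "bdd_above (range (\<lambda>n. \<Sum>i<n. x (m + i)))" by (auto simp: bdd_above_def)
  qed
qed

lemma bdd_above_iff_nat_bound:
  fixes f :: "'a \<Rightarrow> real"
  shows "bdd_above (range f) \<longleftrightarrow> (\<exists>c::nat. \<forall>k. f k \<le> real c)"
  by (auto simp: bdd_above_def) (meson order_trans real_arch_simple)

lemma (in prob_space) indep_unbounded_sums_0_1: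
  fixes X :: "nat \<Rightarrow> 'a \<Rightarrow> real"
  assumes "indep_vars (\<lambda>_. borel) X UNIV"
  defines "A \<equiv> {\<omega>\<in>space M. \<not> bdd_above (range (\<lambda>n. \<Sum>i<n. X i \<omega>))}"
  shows "prob A = 0 \<or> prob A = 1"
proof (rule kolmogorov_0_1_law)
  let ?F = "\<lambda>i. sigma_sets (space M) {X i -` B \<inter> space M | B. B \<in> sets (borel :: real measure)}"
  show "sigma_algebra (space M) (?F i)" for i
    by (rule sigma_algebra_sigma_sets) auto
  show "indep_sets ?F UNIV"
    using assms(1) by (simp add: indep_vars_def)
  show "A \<in> tail_events ?F"
    unfolding tail_events_def
  proof
    fix m
    let ?N = "sigma (space M) (\<Union> (?F ` {m..}))"
    have sub: "\<Union> (?F ` {m..}) \<subseteq> Pow (space M)"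
      by (auto dest: sigma_sets_into_sp[rotated])
    have [measurable]: "X (m + i) \<in> borel_measurable ?N" for i
    proof (rule measurableI)
      fix B :: "real set" assume "B \<in> sets borel"
      then have "X (m + i) -` B \<inter> space M \<in> \<Union> (?F ` {m..})"
        by (intro UnionI[of "?F (m + i)"]) auto
      then show "X (m + i) -` B \<inter> space ?N \<in> sets ?N"
        using sub by (auto simp: space_measure_of_conv)
    qed auto
    have "bdd_above (range (\<lambda>n. \<Sum>i<n. X (m + i) \<omega>)) \<longleftrightarrow> bdd_above (range (\<lambda>n. \<Sum>i<n. X i \<omega>))" for \<omega>
      by (rule bdd_above_shifted_sums_iff)
    then have "A = {\<omega>\<in>space ?N. \<not> (\<exists>c::nat. \<forall>k. (\<Sum>i<k. X (m + i) \<omega>) \<le> real c)}"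
      unfolding A_def bdd_above_iff_nat_bound[symmetric]
      by (simp add: space_measure_of_conv)
    also have "\<dots> \<in> sets ?N" by measurable
    finally show "A \<in> sigma_sets (space M) (\<Union> (?F ` {m..}))"
      using sub by simp
  qed
qed

lemma (in prob_space) iid_shift_expectation:
  fixes X :: "nat \<Rightarrow> 'a \<Rightarrow> real" and f :: "(nat \<Rightarrow> real) \<Rightarrow> real"
  assumes indep: "indep_vars (\<lambda>_. borel) X UNIV"
    and distr: "\<And>i. distr M borel (X i) = distr M borel (X 0)"
    and [measurable]: "f \<in> borel_measurable (Pi\<^sub>M UNIV (\<lambda>_. borel))"
  shows "expectation (\<lambda>\<omega>. f (\<lambda>i. X (Suc i) \<omega>)) = expectation (\<lambda>\<omega>. f (\<lambda>i. X i \<omega>))"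
proof -
  have [measurable]: "random_variable borel (X i)" for i
    using indep by (simp add: indep_vars_def)
  have indep': "indep_vars (\<lambda>_. borel) (\<lambda>i. X (Suc i)) UNIV"
    unfolding indep_vars_def2
  proof (intro conjI ballI indep_setsI)
    fix A and J :: "nat set"
    assume J: "J \<noteq> {}" "finite J"
      and A: "\<forall>j\<in>J. A j \<in> {X (Suc j) -` B \<inter> space M | B. B \<in> sets borel}"
    have "prob (\<Inter>j\<in>Suc ` J. A (j - 1)) = (\<Prod>j\<in>Suc ` J. prob (A (j - 1)))"
      by (rule indep_setsD[where F = "\<lambda>i. {X i -` B \<inter> space M | B. B \<in> sets borel}" and I = UNIV])
        (use indep J A in \<open>auto simp: indep_vars_def2\<close>)
    then show "prob (\<Inter>j\<in>J. A j) = (\<Prod>j\<in>J. prob (A j))"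
      by (simp add: prod.reindex)
  qed auto
  have eq: "distr M (Pi\<^sub>M UNIV (\<lambda>_. borel)) (\<lambda>\<omega> i. X i \<omega>) = Pi\<^sub>M UNIV (\<lambda>i. distr M borel (X i))"
    using indep by (subst (asm) indep_vars_iff_distr_eq_PiM') (auto simp: restrict_UNIV)
  have eq': "distr M (Pi\<^sub>M UNIV (\<lambda>_. borel)) (\<lambda>\<omega> i. X (Suc i) \<omega>)
      = Pi\<^sub>M UNIV (\<lambda>i. distr M borel (X (Suc i)))"
    using indep' by (subst (asm) indep_vars_iff_distr_eq_PiM') (auto simp: restrict_UNIV)
  have "distr M (Pi\<^sub>M UNIV (\<lambda>_. borel)) (\<lambda>\<omega> i. X (Suc i) \<omega>)
      = distr M (Pi\<^sub>M UNIV (\<lambda>_. borel)) (\<lambda>\<omega> i. X i \<omega>)"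
    unfolding eq eq' by (subst (1 2) distr) simp
  then have "integral\<^sup>L (distr M (Pi\<^sub>M UNIV (\<lambda>_. borel)) (\<lambda>\<omega> i. X (Suc i) \<omega>)) f
      = integral\<^sup>L (distr M (Pi\<^sub>M UNIV (\<lambda>_. borel)) (\<lambda>\<omega> i. X i \<omega>)) f"
    by simp
  then show ?thesis
    by (subst (asm) (1 2) integral_distr) (auto intro!: measurable_PiM_single')
qed

lemma integrable_identically_distributed:
  fixes X Y :: "'a \<Rightarrow> real"
  assumes "distr M borel X = distr M borel Y"
    and [measurable]: "X \<in> borel_measurable M" "Y \<in> borel_measurable M"
    and "integrable M Y"
  shows "integrable M X"
proof -
  have "integrable (distr M borel Y) (\<lambda>x. x)"
    using assms(4) by (subst integrable_distr_eq) auto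
  then have "integrable (distr M borel X) (\<lambda>x. x)" by (simp add: assms(1))
  then show ?thesis by (subst (asm) integrable_distr_eq) auto
qed

text \<open>If the sums were unbounded with probability 1, then the increments
  \<open>max_psum (Suc n) X - max_psum n (X \<circ> Suc) = max (- max_psum n (X \<circ> Suc)) (X 0)\<close>, whose
  expectations are nonnegative by stationarity, would converge to \<open>X 0\<close>, whose mean is negative.\<close>

lemma (in prob_space) iid_negative_mean_sums_bounded:
  fixes X :: "nat \<Rightarrow> 'a \<Rightarrow> real"
  assumes indep: "indep_vars (\<lambda>_. borel) X UNIV"
    and distr: "\<And>i. distr M borel (X i) = distr M borel (X 0)"
    and int: "integrable M (X 0)"
    and neg: "expectation (X 0) < 0"
  shows "AE \<omega> in M. bdd_above (range (\<lambda>n. \<Sum>i<n. X i \<omega>))"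
proof -
  have [measurable]: "random_variable borel (X i)" for i
    using indep by (simp add: indep_vars_def)
  have intX: "integrable M (X i)" for i
    by (rule integrable_identically_distributed[OF distr _ _ int]) auto
  have meas[measurable]: "(\<lambda>\<omega>. max_psum n (\<lambda>i. X (m + i) \<omega>)) \<in> borel_measurable M" for n m
    by (rule measurable_compose[OF _ measurable_max_psum]) (auto intro!: measurable_PiM_single')
  note [measurable] = meas[of _ 1, simplified]
  have intF: "integrable M (\<lambda>\<omega>. max_psum n (\<lambda>i. X (m + i) \<omega>))" for n m
  proof (induction n arbitrary: m)
    case (Suc n)
    then show ?case using Suc[of "Suc m"] intX by simp
  qed simp
  define A where "A = {\<omega>\<in>space M. \<not> bdd_above (range (\<lambda>n. \<Sum>i<n. X i \<omega>))}"
  have A_ev [measurable]: "A \<in> events" unfolding A_def bdd_above_iff_nat_bound by measurable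
  have "prob A \<noteq> 1"
  proof
    assume "prob A = 1"
    then have AE: "AE \<omega> in M. \<not> bdd_above (range (\<lambda>n. \<Sum>i<n. X i \<omega>))"
      using prob_eq_1[OF A_ev] by (auto simp: A_def elim: eventually_mono)
    define D where "D n \<omega> = max (- max_psum n (\<lambda>i. X (Suc i) \<omega>)) (X 0 \<omega>)" for n \<omega>
    have D: "D n \<omega> = max_psum (Suc n) (\<lambda>i. X i \<omega>) - max_psum n (\<lambda>i. X (Suc i) \<omega>)" for n \<omega>
      by (simp add: D_def)
    have D_nonneg: "0 \<le> expectation (D n)" for n
    proof -
      have "expectation (\<lambda>\<omega>. max_psum n (\<lambda>i. X (Suc i) \<omega>)) = expectation (\<lambda>\<omega>. max_psum n (\<lambda>i. X i \<omega>))"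
        by (rule iid_shift_expectation[OF indep distr]) auto
      also have "\<dots> \<le> expectation (\<lambda>\<omega>. max_psum (Suc n) (\<lambda>i. X i \<omega>))"
        using intF[of "Suc n" 0] intF[of n 0] by (intro integral_mono max_psum_mono_Suc) simp_all
      moreover have "expectation (D n) = expectation (\<lambda>\<omega>. max_psum (Suc n) (\<lambda>i. X i \<omega>))
          - expectation (\<lambda>\<omega>. max_psum n (\<lambda>i. X (Suc i) \<omega>))"
        unfolding D using intF[of "Suc n" 0] intF[of n 1] by (intro Bochner_Integration.integral_diff) simp_all
      ultimately show ?thesis by simp
    qed
    have "(\<lambda>n. expectation (D n)) \<longlonglongrightarrow> expectation (X 0)"
    proof (rule integral_dominated_convergence[where w = "\<lambda>\<omega>. \<bar>X 0 \<omega>\<bar>"])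
      show "AE \<omega> in M. (\<lambda>n. D n \<omega>) \<longlonglongrightarrow> X 0 \<omega>"
        using AE
      proof eventually_elim
        fix \<omega> assume unb: "\<not> bdd_above (range (\<lambda>n. \<Sum>i<n. X i \<omega>))"
        then have "\<not> bdd_above (range (\<lambda>n. \<Sum>i<n. X (1 + i) \<omega>))"
          using bdd_above_shifted_sums_iff[of "\<lambda>i. X i \<omega>" 1] by simp
        then obtain N where "\<not> (\<Sum>i<N. X (Suc i) \<omega>) \<le> - X 0 \<omega>"
          by (auto simp: bdd_above_def)
        then have N: "max_psum N (\<lambda>i. X (Suc i) \<omega>) \<ge> - X 0 \<omega>"
          using sum_le_max_psum[of "\<lambda>i. X (Suc i) \<omega>" N] by linarith
        have "D n \<omega> = X 0 \<omega>" if "n \<ge> N" for n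
          using lift_Suc_mono_le[of "\<lambda>n. max_psum n (\<lambda>i. X (Suc i) \<omega>)", OF max_psum_mono_Suc that] N
          by (simp add: D_def)
        then show "(\<lambda>n. D n \<omega>) \<longlonglongrightarrow> X 0 \<omega>"
          by (intro tendsto_eventually) (auto simp: eventually_sequentially)
      qed
      show "AE \<omega> in M. norm (D n \<omega>) \<le> \<bar>X 0 \<omega>\<bar>" for n
      proof (rule AE_I2)
        fix \<omega>
        show "norm (D n \<omega>) \<le> \<bar>X 0 \<omega>\<bar>"
          using max_psum_nonneg[of n "\<lambda>i. X (Suc i) \<omega>"] by (simp add: D_def)
      qed
      show "random_variable borel (D n)" for n unfolding D_def by measurable
    qed (use int in auto)
    then have "0 \<le> expectation (X 0)"
      by (rule LIMSEQ_le_const) (use D_nonneg in auto)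
    with neg show False by simp
  qed
  then have "prob A = 0" using indep_unbounded_sums_0_1[OF indep] by (auto simp: A_def)
  then have "AE \<omega> in M. \<omega> \<notin> A" by (subst (asm) prob_eq_0) auto
  then show ?thesis by (auto simp: A_def elim: AE_mp)
qed

lemma (in prob_space) iid_averages_eventually_less:
  fixes X :: "nat \<Rightarrow> 'a \<Rightarrow> real"
  assumes indep: "indep_vars (\<lambda>_. borel) X UNIV"
    and distr: "\<And>i. distr M borel (X i) = distr M borel (X 0)"
    and int: "integrable M (X 0)"
    and less: "expectation (X 0) < c"
  shows "AE \<omega> in M. \<forall>\<^sub>F n in sequentially. (\<Sum>i<n. X i \<omega>) / real n < c"
proof -
  define d where "d = (expectation (X 0) + c) / 2"
  have d: "expectation (X 0) < d" "d < c" using less by (auto simp: d_def)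
  have [measurable]: "random_variable borel (X i)" for i
    using indep by (simp add: indep_vars_def)
  have "AE \<omega> in M. bdd_above (range (\<lambda>n. \<Sum>i<n. X i \<omega> - d))"
  proof (rule iid_negative_mean_sums_bounded)
    show "indep_vars (\<lambda>_. borel) (\<lambda>i \<omega>. X i \<omega> - d) UNIV"
      using indep by (rule indep_vars_compose2) auto
    have "distr M borel (\<lambda>\<omega>. X i \<omega> - d) = distr (distr M borel (X i)) borel (\<lambda>x. x - d)" for i
      by (subst distr_distr) (auto simp: comp_def)
    then show "distr M borel (\<lambda>\<omega>. X i \<omega> - d) = distr M borel (\<lambda>\<omega>. X 0 \<omega> - d)" for i
      using distr by metis
    show "expectation (\<lambda>\<omega>. X 0 \<omega> - d) < 0" using d int by (simp add: prob_space)
  qed (use int in auto)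
  then show ?thesis
  proof eventually_elim
    case (elim \<omega>)
    then obtain b where b: "\<And>n. (\<Sum>i<n. X i \<omega> - d) \<le> b" by (auto simp: bdd_above_def)
    have "(\<lambda>n. b / real n + d) \<longlonglongrightarrow> 0 + d"
      by (intro tendsto_intros lim_const_over_n)
    then have "\<forall>\<^sub>F n in sequentially. b / real n + d < c"
      using d by (intro order_tendstoD(2)) auto
    then show ?case using eventually_gt_at_top[of 0]
    proof eventually_elim
      case (elim n)
      have "(\<Sum>i<n. X i \<omega>) \<le> b + real n * d" using b[of n] by (simp add: sum_subtractf)
      then have "(\<Sum>i<n. X i \<omega>) / real n \<le> b / real n + d" using elim by (simp add: field_simps)
      then show ?case using elim by simp
    qed
  qed
qed

theorem (in prob_space) strong_law_of_large_numbers: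
  fixes X :: "nat \<Rightarrow> 'a \<Rightarrow> real"
  assumes indep: "indep_vars (\<lambda>_. borel) X UNIV"
    and distr: "\<And>i. distr M borel (X i) = distr M borel (X 0)"
    and int: "integrable M (X 0)"
  shows "AE \<omega> in M. (\<lambda>n. (\<Sum>i<n. X i \<omega>) / real n) \<longlonglongrightarrow> expectation (X 0)"
proof -
  define \<mu> where "\<mu> = expectation (X 0)"
  have [measurable]: "random_variable borel (X i)" for i
    using indep by (simp add: indep_vars_def)
  have upper: "AE \<omega> in M. \<forall>\<^sub>F n in sequentially. (\<Sum>i<n. X i \<omega>) / real n < \<mu> + 1 / real (Suc m)" for m
    by (rule iid_averages_eventually_less[OF indep distr int]) (simp add: \<mu>_def)
  have lower: "AE \<omega> in M. \<forall>\<^sub>F n in sequentially. (\<Sum>i<n. - X i \<omega>) / real n < - \<mu> + 1 / real (Suc m)" for m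
  proof (rule iid_averages_eventually_less)
    show "indep_vars (\<lambda>_. borel) (\<lambda>i \<omega>. - X i \<omega>) UNIV"
      using indep by (rule indep_vars_compose2) auto
    have "distr M borel (\<lambda>\<omega>. - X i \<omega>) = distr (distr M borel (X i)) borel uminus" for i
      by (subst distr_distr) (auto simp: comp_def)
    then show "distr M borel (\<lambda>\<omega>. - X i \<omega>) = distr M borel (\<lambda>\<omega>. - X 0 \<omega>)" for i
      using distr by metis
  qed (use int in \<open>auto simp: \<mu>_def\<close>)
  have "AE \<omega> in M. \<forall>m. (\<forall>\<^sub>F n in sequentially. (\<Sum>i<n. X i \<omega>) / real n < \<mu> + 1 / real (Suc m))
      \<and> (\<forall>\<^sub>F n in sequentially. (\<Sum>i<n. - X i \<omega>) / real n < - \<mu> + 1 / real (Suc m))"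
    using upper lower by (simp add: AE_all_countable AE_conj_iff)
  then show ?thesis
  proof eventually_elim
    case (elim \<omega>)
    show ?case
      unfolding \<mu>_def[symmetric]
    proof (rule tendstoI)
      fix e :: real assume "0 < e"
      then obtain m where m: "1 / real (Suc m) < e" using nat_approx_posE by blast
      from elim have "\<forall>\<^sub>F n in sequentially. (\<Sum>i<n. X i \<omega>) / real n < \<mu> + 1 / real (Suc m)"
        "\<forall>\<^sub>F n in sequentially. (\<Sum>i<n. - X i \<omega>) / real n < - \<mu> + 1 / real (Suc m)" by blast+
      then show "\<forall>\<^sub>F n in sequentially. dist ((\<Sum>i<n. X i \<omega>) / real n) \<mu> < e"
        by eventually_elim (use m in \<open>auto simp: dist_real_def sum_negf\<close>)
    qed
  qed
qed

section \<open>Prefix maxima of identically distributed variables\<close>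

lemma (in prob_space) identically_distributed_over_n_tendsto_0:
  fixes Y :: "nat \<Rightarrow> 'a \<Rightarrow> real"
  assumes [measurable]: "\<And>i. random_variable borel (Y i)"
    and distr: "\<And>i. distr M borel (Y i) = distr M borel (Y 0)"
    and nonneg: "\<And>i \<omega>. 0 \<le> Y i \<omega>"
    and int: "integrable M (Y 0)"
  shows "AE \<omega> in M. (\<lambda>n. Y n \<omega> / real n) \<longlonglongrightarrow> 0"
proof -
  have ev: "AE \<omega> in M. \<forall>\<^sub>F n in sequentially. \<omega> \<in> space M - {\<omega>\<in>space M. real n * e < Y n \<omega>}"
    if "0 < e" for e
  proof (rule borel_cantelli_AE1)
    have eq: "emeasure M {\<omega>\<in>space M. real n * e < Y n \<omega>}
        = emeasure M {\<omega>\<in>space M. n < nat \<lceil>Y 0 \<omega> / e\<rceil>}" for n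
    proof -
      have "emeasure M {\<omega>\<in>space M. real n * e < Y k \<omega>} = emeasure (distr M borel (Y k)) {real n * e<..}" for k
        by (subst emeasure_distr) (auto intro!: arg_cong[where f = "emeasure M"])
      then have "emeasure M {\<omega>\<in>space M. real n * e < Y n \<omega>} = emeasure M {\<omega>\<in>space M. real n * e < Y 0 \<omega>}"
        by (simp add: distr[of n])
      also have "{\<omega>\<in>space M. real n * e < Y 0 \<omega>} = {\<omega>\<in>space M. n < nat \<lceil>Y 0 \<omega> / e\<rceil>}"
        using \<open>0 < e\<close> by (auto simp: field_simps zless_nat_eq_int_zless less_ceiling_iff)
      finally show ?thesis .
    qed
    have "(\<Sum>n. emeasure M {\<omega>\<in>space M. real n * e < Y n \<omega>}) = (\<integral>\<^sup>+\<omega>. of_nat (nat \<lceil>Y 0 \<omega> / e\<rceil>) \<partial>M)"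
      unfolding eq by (subst nn_integral_nat_function) auto
    also have "\<dots> \<le> (\<integral>\<^sup>+\<omega>. ennreal (Y 0 \<omega> / e + 1) \<partial>M)"
    proof (rule nn_integral_mono)
      fix \<omega>
      have "real (nat \<lceil>Y 0 \<omega> / e\<rceil>) \<le> Y 0 \<omega> / e + 1"
        using nonneg[of 0 \<omega>] \<open>0 < e\<close> by (simp add: of_nat_nat)
      then show "of_nat (nat \<lceil>Y 0 \<omega> / e\<rceil>) \<le> ennreal (Y 0 \<omega> / e + 1)"
        unfolding ennreal_of_nat_eq_real_of_nat by (rule ennreal_leI)
    qed
    also have "\<dots> < \<infinity>"
      using int nonneg \<open>0 < e\<close> by (subst nn_integral_eq_integral) auto
    finally have "(\<Sum>n. emeasure M {\<omega>\<in>space M. real n * e < Y n \<omega>}) \<noteq> \<top>" by auto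
    then show "summable (\<lambda>n. prob {\<omega>\<in>space M. real n * e < Y n \<omega>})"
      unfolding emeasure_eq_measure by (intro summable_suminf_not_top) auto
  qed (auto simp: emeasure_eq_measure)
  have "AE \<omega> in M. \<forall>m. \<forall>\<^sub>F n in sequentially. \<omega> \<in> space M - {\<omega>\<in>space M. real n * (1 / Suc m) < Y n \<omega>}"
    unfolding AE_all_countable by (intro allI ev) auto
  then show ?thesis
  proof eventually_elim
    case (elim \<omega>)
    show ?case
    proof (rule tendstoI)
      fix e :: real assume "0 < e"
      then obtain m where m: "1 / real (Suc m) < e" using nat_approx_posE by blast
      from elim have "\<forall>\<^sub>F n in sequentially. \<omega> \<in> space M - {\<omega>\<in>space M. real n * (1 / Suc m) < Y n \<omega>}" ..
      then show "\<forall>\<^sub>F n in sequentially. dist (Y n \<omega> / real n) 0 < e"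
        using eventually_gt_at_top[of 0]
      proof eventually_elim
        case (elim n)
        then have "Y n \<omega> / real n \<le> 1 / Suc m" by (auto simp: field_simps not_less)
        then show ?case using m nonneg[of n \<omega>] by (simp add: dist_real_def)
      qed
    qed
  qed
qed

lemma dominated_by_prefix_over_n_tendsto_0:
  fixes a b :: "nat \<Rightarrow> real"
  assumes lim: "(\<lambda>n. a n / real n) \<longlonglongrightarrow> 0"
    and b_nonneg: "\<And>n. 0 \<le> b n"
    and b: "\<And>n. \<exists>i\<le>n. b n \<le> a i"
  shows "(\<lambda>n. b n / real n) \<longlonglongrightarrow> 0"
proof (rule tendstoI)
  fix e :: real assume "0 < e"
  with lim have "\<forall>\<^sub>F n in sequentially. dist (a n / real n) 0 < e" by (rule tendstoD)
  then obtain N where N: "\<And>n. n \<ge> N \<Longrightarrow> \<bar>a n / real n\<bar> < e"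
    by (auto simp: eventually_sequentially dist_real_def)
  define C where "C = Max ((\<lambda>i. a i) ` {..N})"
  have C: "a i \<le> C" if "i \<le> N" for i unfolding C_def using that by (intro Max_ge) auto
  have "(\<lambda>n. C / real n) \<longlonglongrightarrow> 0" by (rule lim_const_over_n)
  then have "\<forall>\<^sub>F n in sequentially. C / real n < e"
    using \<open>0 < e\<close> by (rule order_tendstoD)
  then show "\<forall>\<^sub>F n in sequentially. dist (b n / real n) 0 < e"
    using eventually_gt_at_top[of 0]
  proof eventually_elim
    case (elim n)
    obtain i where i: "i \<le> n" "b n \<le> a i" using b by blast
    have "b n < e * real n"
    proof (cases "i \<le> N")
      case True
      then have "b n \<le> C" using C[of i] i by simp
      then show ?thesis using elim by (simp add: field_simps)
    next
      case False
      then have "a i < e * real i" using N[of i] by (simp add: abs_less_iff field_simps)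
      also have "\<dots> \<le> e * real n" using i \<open>0 < e\<close> by simp
      finally show ?thesis using i by simp
    qed
    then show ?case using elim b_nonneg[of n] by (simp add: dist_real_def field_simps)
  qed
qed

lemma (in prob_space) expectation_dominated_by_prefix_over_n_tendsto_0:
  fixes Y R :: "nat \<Rightarrow> 'a \<Rightarrow> real"
  assumes [measurable]: "\<And>i. random_variable borel (Y i)" "\<And>n. random_variable borel (R n)"
    and distr: "\<And>i. distr M borel (Y i) = distr M borel (Y 0)"
    and nonneg: "\<And>i \<omega>. 0 \<le> Y i \<omega>" "\<And>n \<omega>. 0 \<le> R n \<omega>"
    and int: "integrable M (Y 0)"
    and dom: "\<And>n. AE \<omega> in M. \<exists>i\<le>n. R n \<omega> \<le> Y i \<omega>"
  shows "integrable M (R n)" "(\<lambda>n. expectation (R n) / real n) \<longlonglongrightarrow> 0"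
proof -
  define T where "T K i \<omega> = Y i \<omega> * indicator {real K<..} (Y i \<omega>)" for K :: nat and i \<omega>
  have [measurable]: "random_variable borel (T K i)" for K i unfolding T_def by measurable
  have T_nonneg: "0 \<le> T K i \<omega>" for K i \<omega> using nonneg by (simp add: T_def)
  have T_distr: "distr M borel (T K i) = distr M borel (T K 0)" for K i
  proof -
    have "distr M borel (T K i) = distr (distr M borel (Y i)) borel (\<lambda>y. y * indicator {real K<..} y)" for i
      by (subst distr_distr) (auto simp: T_def[abs_def] comp_def)
    then show ?thesis using distr[of i] by simp
  qed
  have T_eq: "integral\<^sup>L (distr M borel (T K i)) (\<lambda>x. x) = expectation (T K i)"
    "integrable (distr M borel (T K i)) (\<lambda>x. x) \<longleftrightarrow> integrable M (T K i)" for K i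
    by (auto simp: integral_distr integrable_distr_eq)
  have T_int0: "integrable M (T K 0)" for K
    unfolding T_def using int by (rule Bochner_Integration.integrable_bound) (auto simp: indicator_def)
  have T_int: "integrable M (T K i)" for K i
    using T_int0[of K] T_eq(2)[of K i] T_eq(2)[of K 0] T_distr[of K i] by simp
  have T_exp: "expectation (T K i) = expectation (T K 0)" for K i
    using T_eq(1)[of K i] T_eq(1)[of K 0] T_distr[of K i] by simp
  have bound: "AE \<omega> in M. R n \<omega> \<le> real K + (\<Sum>i\<le>n. T K i \<omega>)" for n K
    using dom[of n]
  proof eventually_elim
    case (elim \<omega>)
    then obtain i where i: "i \<le> n" "R n \<omega> \<le> Y i \<omega>" by blast
    have "Y i \<omega> \<le> real K + T K i \<omega>" by (auto simp: T_def indicator_def)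
    also have "T K i \<omega> \<le> (\<Sum>i\<le>n. T K i \<omega>)"
      using i T_nonneg by (intro member_le_sum) auto
    finally show ?case using i by simp
  qed
  have R_int: "integrable M (R n)" for n
  proof (rule Bochner_Integration.integrable_bound)
    show "integrable M (\<lambda>\<omega>. real 0 + (\<Sum>i\<le>n. T 0 i \<omega>))" using T_int by auto
    show "AE \<omega> in M. norm (R n \<omega>) \<le> norm (real 0 + (\<Sum>i\<le>n. T 0 i \<omega>))"
      using bound[of n 0] by eventually_elim (use nonneg(2) in auto)
  qed auto
  then show "integrable M (R n)" .
  have R_exp: "expectation (R n) \<le> real K + (real n + 1) * expectation (T K 0)" for n K
  proof -
    have "expectation (R n) \<le> expectation (\<lambda>\<omega>. real K + (\<Sum>i\<le>n. T K i \<omega>))"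
      using R_int T_int by (intro integral_mono_AE bound) auto
    also have "\<dots> = real K + (\<Sum>i\<le>n. expectation (T K i))"
      using T_int by (simp add: prob_space)
    also have "\<dots> = real K + (real n + 1) * expectation (T K 0)"
      by (subst T_exp) simp
    finally show ?thesis .
  qed
  have T_lim: "(\<lambda>K. expectation (T K 0)) \<longlonglongrightarrow> expectation (\<lambda>_. 0)"
  proof (rule integral_dominated_convergence[where w = "Y 0"])
    show "AE \<omega> in M. (\<lambda>K. T K 0 \<omega>) \<longlonglongrightarrow> 0"
    proof (rule AE_I2, rule tendsto_eventually)
      fix \<omega>
      obtain N :: nat where "Y 0 \<omega> \<le> real N" using real_arch_simple by blast
      then show "\<forall>\<^sub>F K in sequentially. T K 0 \<omega> = 0"
        by (intro eventually_sequentiallyI[of N]) (auto simp: T_def)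
    qed
  qed (use int nonneg in \<open>auto simp: T_def indicator_def\<close>)
  show "(\<lambda>n. expectation (R n) / real n) \<longlonglongrightarrow> 0"
  proof (rule tendstoI)
    fix e :: real assume "0 < e"
    have "\<forall>\<^sub>F K in sequentially. expectation (T K 0) < e / 2"
      using order_tendstoD(2)[OF T_lim, of "e / 2"] \<open>0 < e\<close> by simp
    then obtain K where K: "expectation (T K 0) < e / 2"
      by (auto simp: eventually_sequentially)
    define c where "c = expectation (T K 0)"
    have "(\<lambda>n. (real K + c) / real n + c) \<longlonglongrightarrow> 0 + c"
      by (intro tendsto_intros lim_const_over_n)
    then have "\<forall>\<^sub>F n in sequentially. (real K + c) / real n + c < e"
      by (rule order_tendstoD(2)) (use K \<open>0 < e\<close> in \<open>simp add: c_def\<close>)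
    then show "\<forall>\<^sub>F n in sequentially. dist (expectation (R n) / real n) 0 < e"
      using eventually_gt_at_top[of 0]
    proof eventually_elim
      case (elim n)
      have "expectation (R n) / real n \<le> (real K + c) / real n + c"
        using R_exp[of n K] elim by (simp add: c_def field_simps)
      moreover have "0 \<le> expectation (R n)" using nonneg by (intro integral_nonneg_AE) auto
      ultimately show ?case using elim by (simp add: dist_real_def)
    qed
  qed
qed

section \<open>Convergence in mean and in distribution\<close>

lemma (in prob_space) scheffe_constant_limit:
  fixes f :: "nat \<Rightarrow> 'a \<Rightarrow> real"
  assumes int: "\<And>n. integrable M (f n)" and nonneg: "\<And>n \<omega>. 0 \<le> f n \<omega>"
    and lim: "AE \<omega> in M. (\<lambda>n. f n \<omega>) \<longlonglongrightarrow> c"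
    and lim_exp: "(\<lambda>n. expectation (f n)) \<longlonglongrightarrow> c"
    and "0 \<le> c"
  shows "(\<lambda>n. expectation (\<lambda>\<omega>. \<bar>f n \<omega> - c\<bar>)) \<longlonglongrightarrow> 0"
proof -
  have [measurable]: "f n \<in> borel_measurable M" for n using int by auto
  have int': "integrable M (\<lambda>\<omega>. max 0 (c - f n \<omega>))" for n using int by auto
  have "(\<lambda>n. expectation (\<lambda>\<omega>. max 0 (c - f n \<omega>))) \<longlonglongrightarrow> expectation (\<lambda>_. 0)"
  proof (rule integral_dominated_convergence[where w = "\<lambda>_. c"])
    show "AE \<omega> in M. (\<lambda>n. max 0 (c - f n \<omega>)) \<longlonglongrightarrow> 0"
      using lim
    proof eventually_elim
      case (elim \<omega>)
      have "(\<lambda>n. max 0 (c - f n \<omega>)) \<longlonglongrightarrow> max 0 (c - c)"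
        by (intro tendsto_intros elim)
      then show ?case by simp
    qed
  qed (use nonneg \<open>0 \<le> c\<close> in auto)
  then have "(\<lambda>n. expectation (f n) - c + 2 * expectation (\<lambda>\<omega>. max 0 (c - f n \<omega>))) \<longlonglongrightarrow> c - c + 2 * 0"
    by (intro tendsto_intros lim_exp) simp
  moreover have "expectation (\<lambda>\<omega>. \<bar>f n \<omega> - c\<bar>) = expectation (f n) - c + 2 * expectation (\<lambda>\<omega>. max 0 (c - f n \<omega>))" for n
  proof -
    have "\<bar>f n \<omega> - c\<bar> = f n \<omega> - c + 2 * max 0 (c - f n \<omega>)" for \<omega>
      by (simp add: abs_if max_def)
    then show ?thesis using int[of n] int'[of n] by (simp add: prob_space)
  qed
  ultimately show ?thesis by simp
qed

lemma tendsto_sqrt_of_square_over_n: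
  fixes b :: "nat \<Rightarrow> real"
  assumes "(\<lambda>n. (b n)\<^sup>2 / real n) \<longlonglongrightarrow> 0" and "\<And>n. 0 \<le> b n"
  shows "(\<lambda>n. b n / sqrt (real n)) \<longlonglongrightarrow> 0"
  using tendsto_real_sqrt[OF assms(1)] assms(2) by (simp add: real_sqrt_divide)

lemma (in prob_space) slutsky_add_null_sequence:
  fixes Z B :: "nat \<Rightarrow> 'a \<Rightarrow> real"
  assumes [measurable]: "\<And>n. random_variable borel (Z n)" "\<And>n. random_variable borel (B n)"
    and conv: "weak_conv_m (\<lambda>n. distr M borel (Z n)) \<mu>" and \<mu>: "real_distribution \<mu>"
    and null: "AE \<omega> in M. (\<lambda>n. B n \<omega>) \<longlonglongrightarrow> 0"
  shows "weak_conv_m (\<lambda>n. distr M borel (\<lambda>\<omega>. Z n \<omega> + B n \<omega>)) \<mu>"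
proof (rule levy_continuity)
  show "real_distribution (distr M borel (\<lambda>\<omega>. Z n \<omega> + B n \<omega>))" for n
    by (rule real_distribution_distr) auto
  fix t
  have 1: "(\<lambda>n. char (distr M borel (Z n)) t) \<longlonglongrightarrow> char \<mu> t"
    by (rule levy_continuity1[OF _ \<mu> conv]) (auto intro: real_distribution_distr)
  have "(\<lambda>n. expectation (\<lambda>\<omega>. cmod (iexp (t * B n \<omega>) - 1))) \<longlonglongrightarrow> expectation (\<lambda>_. 0)"
  proof (rule integral_dominated_convergence[where w = "\<lambda>_. 2"])
    show "AE \<omega> in M. (\<lambda>n. cmod (iexp (t * B n \<omega>) - 1)) \<longlonglongrightarrow> 0"
      using null
    proof eventually_elim
      case (elim \<omega>)
      have "(\<lambda>n. cmod (iexp (t * B n \<omega>) - 1)) \<longlonglongrightarrow> cmod (iexp (t * 0) - 1)"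
        by (intro tendsto_intros elim)
      then show ?case by simp
    qed
    show "AE \<omega> in M. norm (cmod (iexp (t * B n \<omega>) - 1)) \<le> 2" for n
      by (intro AE_I2) (auto intro!: order_trans[OF norm_triangle_ineq4])
  qed auto
  then have 2: "(\<lambda>n. expectation (\<lambda>\<omega>. cmod (iexp (t * B n \<omega>) - 1))) \<longlonglongrightarrow> 0" by simp
  have diff: "cmod (char (distr M borel (\<lambda>\<omega>. Z n \<omega> + B n \<omega>)) t - char (distr M borel (Z n)) t)
      \<le> expectation (\<lambda>\<omega>. cmod (iexp (t * B n \<omega>) - 1))" for n
  proof -
    have "char (distr M borel (\<lambda>\<omega>. Z n \<omega> + B n \<omega>)) t - char (distr M borel (Z n)) t
        = (CLINT \<omega>|M. iexp (t * (Z n \<omega> + B n \<omega>))) - (CLINT \<omega>|M. iexp (t * Z n \<omega>))"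
      unfolding char_def by (subst (1 2) integral_distr) auto
    also have "\<dots> = (CLINT \<omega>|M. iexp (t * (Z n \<omega> + B n \<omega>)) - iexp (t * Z n \<omega>))"
      by (intro Bochner_Integration.integral_diff[symmetric] integrable_const_bound[where B = 1] AE_I2) auto
    also have "cmod \<dots> \<le> (\<integral>\<omega>. cmod (iexp (t * (Z n \<omega> + B n \<omega>)) - iexp (t * Z n \<omega>)) \<partial>M)"
      by (rule integral_norm_bound)
    also have "\<dots> = (\<integral>\<omega>. cmod (iexp (t * B n \<omega>) - 1) \<partial>M)"
    proof (rule Bochner_Integration.integral_cong[OF refl])
      fix \<omega>
      have "iexp (t * (Z n \<omega> + B n \<omega>)) - iexp (t * Z n \<omega>) = iexp (t * Z n \<omega>) * (iexp (t * B n \<omega>) - 1)"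
        by (simp add: algebra_simps exp_add)
      then show "cmod (iexp (t * (Z n \<omega> + B n \<omega>)) - iexp (t * Z n \<omega>)) = cmod (iexp (t * B n \<omega>) - 1)"
        by (simp add: norm_mult)
    qed
    finally show ?thesis .
  qed
  have "(\<lambda>n. char (distr M borel (\<lambda>\<omega>. Z n \<omega> + B n \<omega>)) t - char (distr M borel (Z n)) t) \<longlonglongrightarrow> 0"
    by (rule Lim_null_comparison[OF always_eventually 2]) (use diff in auto)
  from tendsto_add[OF this 1]
  show "(\<lambda>n. char (distr M borel (\<lambda>\<omega>. Z n \<omega> + B n \<omega>)) t) \<longlonglongrightarrow> char \<mu> t" by simp
qed (rule \<mu>)

lemma real_distribution_normal:
  "0 < \<sigma> \<Longrightarrow> real_distribution (density lborel (normal_density 0 \<sigma>))"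
  by (simp add: real_distribution_def real_distribution_axioms_def prob_space_normal_density)

lemma char_normal_distribution:
  assumes "0 < \<sigma>"
  shows "char (density lborel (normal_density 0 \<sigma>)) t = char std_normal_distribution (\<sigma> * t)"
proof -
  interpret N: real_distribution std_normal_distribution by (rule real_dist_normal_dist)
  have "distributed std_normal_distribution lborel (\<lambda>x. x) std_normal_density"
    by (auto simp: distributed_def distr_id2)
  from N.normal_density_affine[OF this, of \<sigma> 0] assms
  have "distributed std_normal_distribution lborel (\<lambda>x. \<sigma> * x) (normal_density 0 \<sigma>)" by simp
  then have "density lborel (normal_density 0 \<sigma>) = distr std_normal_distribution lborel (\<lambda>x. \<sigma> * x)"
    by (simp add: distributed_def)
  then show ?thesis
    by (simp add: char_def integral_distr mult_ac)
qed

lemma (in prob_space) weak_conv_m_scale_normal: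
  fixes Z :: "nat \<Rightarrow> 'a \<Rightarrow> real"
  assumes [measurable]: "\<And>n. random_variable borel (Z n)" and "0 < \<sigma>"
    and conv: "weak_conv_m (\<lambda>n. distr M borel (Z n)) std_normal_distribution"
  shows "weak_conv_m (\<lambda>n. distr M borel (\<lambda>\<omega>. \<sigma> * Z n \<omega>)) (density lborel (normal_density 0 \<sigma>))"
proof (rule levy_continuity)
  show "real_distribution (distr M borel (\<lambda>\<omega>. \<sigma> * Z n \<omega>))" for n
    by (rule real_distribution_distr) auto
  fix t
  have "char (distr M borel (\<lambda>\<omega>. \<sigma> * Z n \<omega>)) t = char (distr M borel (Z n)) (\<sigma> * t)" for n
    unfolding char_def by (subst (1 2) integral_distr) (auto simp: mult_ac)
  moreover have "(\<lambda>n. char (distr M borel (Z n)) (\<sigma> * t)) \<longlonglongrightarrow> char std_normal_distribution (\<sigma> * t)"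
    by (rule levy_continuity1[OF _ _ conv]) (auto intro: real_distribution_distr real_dist_normal_dist)
  ultimately show "(\<lambda>n. char (distr M borel (\<lambda>\<omega>. \<sigma> * Z n \<omega>)) t) \<longlonglongrightarrow> char (density lborel (normal_density 0 \<sigma>)) t"
    by (simp add: char_normal_distribution[OF \<open>0 < \<sigma>\<close>])
qed (rule real_distribution_normal[OF \<open>0 < \<sigma>\<close>])

section \<open>Poisson counts below a random level\<close>

lemma sums_poisson_moment1:
  fixes x :: real
  shows "(\<lambda>t. real t * (exp (- x) * x ^ t / fact t)) sums x"
proof -
  have "(\<lambda>t. x * exp (- x) * (x ^ t / fact t)) sums (x * exp (- x) * exp x)"
    using exp_converges[of x] by (intro sums_mult) (simp add: divide_inverse_commute)
  then have "(\<lambda>t. real (Suc t) * (exp (- x) * x ^ Suc t / fact (Suc t))) sums x"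
    by (simp add: exp_minus field_simps del: of_nat_Suc)
  from sums_Suc[OF this] show ?thesis by simp
qed

lemma sums_poisson_moment2:
  fixes x :: real
  shows "(\<lambda>t. (real t)\<^sup>2 * (exp (- x) * x ^ t / fact t)) sums (x + x\<^sup>2)"
proof -
  have "(\<lambda>t. x * exp (- x) * (x ^ t / fact t)) sums (x * exp (- x) * exp x)"
    using exp_converges[of x] by (intro sums_mult) (simp add: divide_inverse_commute)
  from sums_add[OF sums_mult[OF sums_poisson_moment1] this]
  have "(\<lambda>t. x * (real t * (exp (- x) * x ^ t / fact t)) + x * exp (- x) * (x ^ t / fact t))
      sums (x * x + x * exp (- x) * exp x)"
    .
  moreover have "x * (real t * (exp (- x) * x ^ t / fact t)) + x * exp (- x) * (x ^ t / fact t)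
      = (real (Suc t))\<^sup>2 * (exp (- x) * x ^ Suc t / fact (Suc t))" for t
    by (simp add: power2_eq_square divide_simps) (simp add: algebra_simps)
  moreover have "x * x + x * exp (- x) * exp x = x + x\<^sup>2"
    by (simp add: exp_minus power2_eq_square)
  ultimately have "(\<lambda>t. (real (Suc t))\<^sup>2 * (exp (- x) * x ^ Suc t / fact (Suc t))) sums (x + x\<^sup>2)"
    by (simp only:)
  from sums_Suc[OF this] show ?thesis by simp
qed

lemma poisson_ppD:
  assumes "poisson_pp M \<theta> l"
  shows "l j \<in> borel_measurable M"
    and "\<omega> \<in> space M \<Longrightarrow> 0 < l 0 \<omega>"
    and "\<omega> \<in> space M \<Longrightarrow> strict_mono (\<lambda>j. l j \<omega>)"
    and "\<omega> \<in> space M \<Longrightarrow> filterlim (\<lambda>j. l j \<omega>) at_top sequentially"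
  using assms unfolding poisson_pp_def by blast+

definition atoms_below :: "(nat \<Rightarrow> real) \<Rightarrow> ennreal \<Rightarrow> nat" where
  "atoms_below x h = card {j. ennreal (x j) < h}"

lemma measurable_atoms_below [measurable]:
  "(\<lambda>p. atoms_below (snd p) (fst p)) \<in> borel \<Otimes>\<^sub>M Pi\<^sub>M UNIV (\<lambda>_. borel) \<rightarrow>\<^sub>M count_space UNIV"
  unfolding atoms_below_def by measurable

context prob_space
begin

lemma prob_atoms_below:
  assumes PP: "poisson_pp M \<theta> L" and "0 < r"
  shows "prob {\<omega>\<in>space M. atoms_below (\<lambda>j. L j \<omega>) (ennreal r) = t}
    = exp (- (\<theta> * r)) * (\<theta> * r) ^ t / fact t"
proof -
  have pos: "0 < L j \<omega>" if "\<omega> \<in> space M" for j \<omega>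
    using poisson_ppD(2,3)[OF PP that] strict_mono_less_eq[of "\<lambda>j. L j \<omega>" 0 j] by simp
  have "{\<omega>\<in>space M. atoms_below (\<lambda>j. L j \<omega>) (ennreal r) = t}
      = {\<omega>\<in>space M. pp_count (\<lambda>j. L j \<omega>) {0<..<r} = t}"
    using \<open>0 < r\<close> by (auto simp: atoms_below_def pp_count_def pos ennreal_less_iff less_imp_le)
  moreover have "prob {\<omega>\<in>space M. pp_count (\<lambda>j. L j \<omega>) {0<..<r} = t}
      = exp (- (\<theta> * measure lborel {0<..<r})) * (\<theta> * measure lborel {0<..<r}) ^ t / fact t"
    using PP unfolding poisson_pp_def by (elim conjE allE[of _ "{0<..<r}"] allE[of _ t]) auto
  ultimately show ?thesis using \<open>0 < r\<close> by simp
qed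

context
  fixes h :: "'a \<Rightarrow> ennreal" and L :: "nat \<Rightarrow> 'a \<Rightarrow> real" and \<theta> :: real
  assumes PP: "poisson_pp M \<theta> L"
    and h_meas [measurable]: "random_variable borel h"
    and h_pos: "\<And>\<omega>. \<omega> \<in> space M \<Longrightarrow> 0 < h \<omega>"
    and h_fin: "AE \<omega> in M. h \<omega> < \<top>"
    and indep: "\<And>A B. A \<in> sets borel \<Longrightarrow> B \<in> sets (Pi\<^sub>M UNIV (\<lambda>_. borel)) \<Longrightarrow>
      prob ((h -` A \<inter> space M) \<inter> ((\<lambda>\<omega> j. L j \<omega>) -` B \<inter> space M))
        = prob (h -` A \<inter> space M) * prob ((\<lambda>\<omega> j. L j \<omega>) -` B \<inter> space M)"
begin

lemma L_meas: "(\<lambda>\<omega> j. L j \<omega>) \<in> M \<rightarrow>\<^sub>M Pi\<^sub>M UNIV (\<lambda>_. borel)"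
  by (intro measurable_PiM_single') (auto intro: poisson_ppD(1)[OF PP])

lemma atoms_below_meas:
  "(\<lambda>\<omega>. atoms_below (\<lambda>j. L j \<omega>) (h \<omega>)) \<in> M \<rightarrow>\<^sub>M count_space UNIV"
  using measurable_compose[OF measurable_Pair[OF h_meas L_meas] measurable_atoms_below] by simp

lemma emeasure_mixed_poisson:
  "emeasure M {\<omega>\<in>space M. atoms_below (\<lambda>j. L j \<omega>) (h \<omega>) = t}
    = (\<integral>\<^sup>+y. ennreal (exp (- (\<theta> * enn2real y)) * (\<theta> * enn2real y) ^ t / fact t) \<partial>distr M borel h)"
proof -
  note [measurable] = L_meas
  let ?P = "Pi\<^sub>M UNIV (\<lambda>_::nat. borel :: real measure)"
  let ?h = "distr M borel h" and ?L = "distr M ?P (\<lambda>\<omega> j. L j \<omega>)"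
  interpret h: prob_space ?h by (rule prob_space_distr) simp
  interpret L: prob_space ?L by (rule prob_space_distr) simp
  have joint: "?h \<Otimes>\<^sub>M ?L = distr M (borel \<Otimes>\<^sub>M ?P) (\<lambda>\<omega>. (h \<omega>, \<lambda>j. L j \<omega>))"
  proof (rule pair_measure_eqI)
    fix A B assume "A \<in> sets ?h" "B \<in> sets ?L"
    then have AB: "A \<in> sets borel" "B \<in> sets ?P" by auto
    have "emeasure ?h A * emeasure ?L B
        = ennreal (prob (h -` A \<inter> space M) * prob ((\<lambda>\<omega> j. L j \<omega>) -` B \<inter> space M))"
      using AB by (simp add: emeasure_distr emeasure_eq_measure ennreal_mult)
    also have "\<dots> = emeasure M ((h -` A \<inter> space M) \<inter> ((\<lambda>\<omega> j. L j \<omega>) -` B \<inter> space M))"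
      by (simp add: indep[OF AB] emeasure_eq_measure)
    also have "\<dots> = emeasure (distr M (borel \<Otimes>\<^sub>M ?P) (\<lambda>\<omega>. (h \<omega>, \<lambda>j. L j \<omega>))) (A \<times> B)"
      using AB by (subst emeasure_distr) (auto intro!: arg_cong[where f = "emeasure M"])
    finally show "emeasure ?h A * emeasure ?L B
        = emeasure (distr M (borel \<Otimes>\<^sub>M ?P) (\<lambda>\<omega>. (h \<omega>, \<lambda>j. L j \<omega>))) (A \<times> B)" .
  qed (auto simp: h.sigma_finite_measure_axioms L.sigma_finite_measure_axioms
      intro!: sets_pair_measure_cong)
  define E where "E = {p \<in> space (borel \<Otimes>\<^sub>M ?P). atoms_below (snd p) (fst p) = t}"
  have E: "E \<in> sets (borel \<Otimes>\<^sub>M ?P)" unfolding E_def by measurable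
  have "emeasure M {\<omega>\<in>space M. atoms_below (\<lambda>j. L j \<omega>) (h \<omega>) = t}
      = emeasure (distr M (borel \<Otimes>\<^sub>M ?P) (\<lambda>\<omega>. (h \<omega>, \<lambda>j. L j \<omega>))) E"
    using E by (subst emeasure_distr)
      (auto simp: E_def space_pair_measure space_PiM intro!: arg_cong[where f = "emeasure M"])
  also have "\<dots> = (\<integral>\<^sup>+y. emeasure ?L (Pair y -` E) \<partial>?h)"
    unfolding joint[symmetric]
    by (rule L.emeasure_pair_measure_alt) (use E in \<open>simp cong: sets_pair_measure_cong\<close>)
  also have "\<dots> = (\<integral>\<^sup>+y. ennreal (exp (- (\<theta> * enn2real y)) * (\<theta> * enn2real y) ^ t / fact t) \<partial>?h)"
  proof (rule nn_integral_cong_AE)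
    have "AE y in ?h. 0 < y \<and> y < \<top>"
      using h_fin h_pos by (subst AE_distr_iff) auto
    then show "AE y in ?h. emeasure ?L (Pair y -` E)
        = ennreal (exp (- (\<theta> * enn2real y)) * (\<theta> * enn2real y) ^ t / fact t)"
    proof eventually_elim
      case (elim y)
      then have y: "y = ennreal (enn2real y)" "0 < enn2real y"
        by (auto simp: enn2real_positive_iff)
      have "emeasure ?L (Pair y -` E) = emeasure M {\<omega>\<in>space M. atoms_below (\<lambda>j. L j \<omega>) y = t}"
        using sets_Pair1[OF E, of y] by (subst emeasure_distr)
          (auto simp: E_def space_pair_measure space_PiM intro!: arg_cong[where f = "emeasure M"])
      then show ?case
        using prob_atoms_below[OF PP y(2), of t] y(1) by (simp add: emeasure_eq_measure)
    qed
  qed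
  finally show ?thesis .
qed

lemma nn_integral_mixed_poisson:
  fixes f :: "nat \<Rightarrow> real"
  assumes "0 \<le> \<theta>" and f_nonneg: "\<And>t. 0 \<le> f t"
    and f_sums: "\<And>x. 0 \<le> x \<Longrightarrow> (\<lambda>t. f t * (exp (- x) * x ^ t / fact t)) sums g x"
  shows "(\<integral>\<^sup>+\<omega>. ennreal (f (atoms_below (\<lambda>j. L j \<omega>) (h \<omega>))) \<partial>M)
    = (\<integral>\<^sup>+\<omega>. ennreal (g (\<theta> * enn2real (h \<omega>))) \<partial>M)"
proof -
  note [measurable] = atoms_below_meas
  let ?N = "\<lambda>\<omega>. atoms_below (\<lambda>j. L j \<omega>) (h \<omega>)"
  have f_eq: "ennreal (f n) = (\<Sum>t. ennreal (f t) * indicator {t} n)" for n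
    by (subst suminf_finite[of "{n}"]) auto
  have "(\<integral>\<^sup>+\<omega>. ennreal (f (?N \<omega>)) \<partial>M) = (\<integral>\<^sup>+\<omega>. (\<Sum>t. ennreal (f t) * indicator {t} (?N \<omega>)) \<partial>M)"
    by (intro nn_integral_cong f_eq)
  also have "\<dots> = (\<Sum>t. \<integral>\<^sup>+\<omega>. ennreal (f t) * indicator {t} (?N \<omega>) \<partial>M)"
    by (rule nn_integral_suminf) (rule measurable_compose[OF atoms_below_meas], simp)
  also have "\<dots> = (\<Sum>t. \<integral>\<^sup>+\<omega>. ennreal (f t * (exp (- (\<theta> * enn2real (h \<omega>))) * (\<theta> * enn2real (h \<omega>)) ^ t / fact t)) \<partial>M)"
  proof (rule suminf_cong)
    fix t
    have "(\<integral>\<^sup>+\<omega>. ennreal (f t) * indicator {t} (?N \<omega>) \<partial>M)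
        = (\<integral>\<^sup>+\<omega>. ennreal (f t) * indicator {\<omega>\<in>space M. ?N \<omega> = t} \<omega> \<partial>M)"
      by (intro nn_integral_cong) (auto simp: indicator_def)
    also have "\<dots> = ennreal (f t) * emeasure M {\<omega>\<in>space M. ?N \<omega> = t}"
      by (rule nn_integral_cmult_indicator) measurable
    also have "\<dots> = ennreal (f t) * (\<integral>\<^sup>+\<omega>. ennreal (exp (- (\<theta> * enn2real (h \<omega>))) * (\<theta> * enn2real (h \<omega>)) ^ t / fact t) \<partial>M)"
      unfolding emeasure_mixed_poisson by (subst nn_integral_distr) auto
    also have "\<dots> = (\<integral>\<^sup>+\<omega>. ennreal (f t) * ennreal (exp (- (\<theta> * enn2real (h \<omega>))) * (\<theta> * enn2real (h \<omega>)) ^ t / fact t) \<partial>M)"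
      by (rule nn_integral_cmult[symmetric]) simp
    also have "\<dots> = (\<integral>\<^sup>+\<omega>. ennreal (f t * (exp (- (\<theta> * enn2real (h \<omega>))) * (\<theta> * enn2real (h \<omega>)) ^ t / fact t)) \<partial>M)"
      by (intro nn_integral_cong ennreal_mult'[symmetric] f_nonneg)
    finally show "(\<integral>\<^sup>+\<omega>. ennreal (f t) * indicator {t} (?N \<omega>) \<partial>M) = \<dots>" .
  qed
  also have "\<dots> = (\<integral>\<^sup>+\<omega>. (\<Sum>t. ennreal (f t * (exp (- (\<theta> * enn2real (h \<omega>))) * (\<theta> * enn2real (h \<omega>)) ^ t / fact t))) \<partial>M)"
    by (rule nn_integral_suminf[symmetric]) simp
  also have "\<dots> = (\<integral>\<^sup>+\<omega>. ennreal (g (\<theta> * enn2real (h \<omega>))) \<partial>M)"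
    using f_nonneg \<open>0 \<le> \<theta>\<close> by (intro nn_integral_cong suminf_ennreal_eq f_sums) auto
  finally show ?thesis .
qed

end

end

lemma finite_atoms_below:
  assumes "filterlim x at_top sequentially" and "h < (\<top> :: ennreal)"
  shows "finite {j. ennreal (x j) < h}"
proof -
  obtain r where r: "0 \<le> r" "h = ennreal r" using assms(2) by (cases h) auto
  from assms(1) have "\<forall>\<^sub>F j in sequentially. r \<le> x j" by (auto simp: filterlim_at_top)
  then obtain n where n: "\<And>j. j \<ge> n \<Longrightarrow> r \<le> x j" by (auto simp: eventually_sequentially)
  have "{j. ennreal (x j) < h} \<subseteq> {..<n}"
  proof safe
    fix j assume "ennreal (x j) < h"
    then have "x j < r" using r by (metis ennreal_leI not_le)
    then show "j < n" using n[of j] by (cases "j < n") auto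
  qed
  then show ?thesis by (rule finite_subset) auto
qed

lemma measurable_card_nat_pairs:
  fixes S :: "'a \<Rightarrow> (nat \<times> nat) set"
  assumes [measurable]: "\<And>i j. {\<omega>\<in>space M. (i, j) \<in> S \<omega>} \<in> sets M"
  shows "(\<lambda>\<omega>. card (S \<omega>)) \<in> M \<rightarrow>\<^sub>M count_space UNIV"
proof -
  have "card (S \<omega>) = card {k. prod_decode k \<in> S \<omega>}" for \<omega>
  proof (rule bij_betw_same_card[of prod_encode])
    show "bij_betw prod_encode (S \<omega>) {k. prod_decode k \<in> S \<omega>}"
      by (rule bij_betw_byWitness[of _ prod_decode]) auto
  qed
  moreover have "(\<lambda>\<omega>. card {k. prod_decode k \<in> S \<omega>}) \<in> M \<rightarrow>\<^sub>M count_space UNIV"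
  proof (rule measurable_card)
    fix k
    show "{\<omega>\<in>space M. k \<in> {k. prod_decode k \<in> S \<omega>}} \<in> sets M"
      using assms by (cases "prod_decode k") simp
  qed
  ultimately show ?thesis by simp
qed

section \<open>Polymorphic sites\<close>

theorem theorem2p1:
  fixes M :: "'a measure" and H :: "nat \<Rightarrow> 'a \<Rightarrow> ennreal"
    and l :: "nat \<Rightarrow> nat \<Rightarrow> 'a \<Rightarrow> real" and \<theta> :: real
  assumes "prob_space M"
    and "\<theta> > 0"
    and H_meas: "\<And>i. H i \<in> borel_measurable M"
    and H_pos: "\<And>i \<omega>. i \<ge> 1 \<Longrightarrow> \<omega> \<in> space M \<Longrightarrow> H i \<omega> > 0"
    and H0: "\<And>\<omega>. \<omega> \<in> space M \<Longrightarrow> H 0 \<omega> = \<infinity>"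
    and H_id: "\<And>i. i \<ge> 1 \<Longrightarrow> distr M borel (H i) = distr M borel (H 1)"
    and PP: "\<And>i. poisson_pp M \<theta> (l i)"
    and indep: "prob_space.indep_sets M
        (\<lambda>k. case k of
               Inl i \<Rightarrow> {H i -` A \<inter> space M | A. A \<in> sets (borel :: ennreal measure)}
             | Inr i \<Rightarrow> {(\<lambda>\<omega>. \<lambda>j. l i j \<omega>) -` A \<inter> space M | A.
                           A \<in> sets (Pi\<^sub>M UNIV (\<lambda>_::nat. (borel :: real measure)))})
        (UNIV :: (nat + nat) set)"
    and EH: "(\<integral>\<^sup>+ \<omega>. H 1 \<omega> \<partial>M) < \<infinity>"
  shows "(AE \<omega> in M. (\<lambda>n. real (seg_sites H l n \<omega>) / real n)
            \<longlonglongrightarrow> \<theta> * enn2real (\<integral>\<^sup>+ \<omega>. H 1 \<omega> \<partial>M))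
       \<and> (\<forall>n. integrable M (\<lambda>\<omega>. real (seg_sites H l n \<omega>)))
       \<and> (\<lambda>n. \<integral>\<omega>. \<bar>real (seg_sites H l n \<omega>) / real n
                     - \<theta> * enn2real (\<integral>\<^sup>+ \<omega>. H 1 \<omega> \<partial>M)\<bar> \<partial>M) \<longlonglongrightarrow> 0
       \<and> ((\<integral>\<^sup>+ \<omega>. (H 1 \<omega>)\<^sup>2 \<partial>M) < \<infinity> \<longrightarrow>
           weak_conv_m
             (\<lambda>n. distr M borel (\<lambda>\<omega>. sqrt (real n) *
                 (real (seg_sites H l n \<omega>) / real n - \<theta> * enn2real (\<integral>\<^sup>+ \<omega>. H 1 \<omega> \<partial>M))))
             (density lborel (normal_density 0
                (sqrt (\<theta> * enn2real (\<integral>\<^sup>+ \<omega>. H 1 \<omega> \<partial>M)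
                   + \<theta>\<^sup>2 * (enn2real (\<integral>\<^sup>+ \<omega>. (H 1 \<omega>)\<^sup>2 \<partial>M)
                             - (enn2real (\<integral>\<^sup>+ \<omega>. H 1 \<omega> \<partial>M))\<^sup>2))))))"
proof -
  interpret prob_space M by fact
  note [measurable] = H_meas and One_nat_def [simp del]
  let ?P = "Pi\<^sub>M UNIV (\<lambda>_::nat. borel :: real measure)"
  define E where "E = (\<lambda>k. case k of
      Inl i \<Rightarrow> {H i -` A \<inter> space M | A. A \<in> sets (borel :: ennreal measure)}
    | Inr i \<Rightarrow> {(\<lambda>\<omega> j. l i j \<omega>) -` A \<inter> space M | A. A \<in> sets ?P})"
  have indep: "indep_sets E UNIV" using indep by (simp add: E_def)
  have l_meas [measurable]: "l i j \<in> borel_measurable M" for i j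
    by (rule poisson_ppD(1)[OF PP])
  have l_lim: "filterlim (\<lambda>j. l i j \<omega>) at_top sequentially" if "\<omega> \<in> space M" for i \<omega>
    by (rule poisson_ppD(4)[OF PP that])
  define m where "m = enn2real (\<integral>\<^sup>+ \<omega>. H 1 \<omega> \<partial>M)"
  have m: "(\<integral>\<^sup>+ \<omega>. H 1 \<omega> \<partial>M) = ennreal m" using EH by (simp add: m_def)
  have H_fin: "AE \<omega> in M. H i \<omega> < \<top>" if "i \<ge> 1" for i
  proof -
    have "(\<integral>\<^sup>+ y. y \<partial>distr M borel (H i)) = ennreal m"
      unfolding H_id[OF that] by (subst nn_integral_distr) (auto simp: m)
    then have "(\<integral>\<^sup>+ \<omega>. H i \<omega> \<partial>M) = ennreal m"
      by (subst (asm) nn_integral_distr) auto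
    then have "AE \<omega> in M. H i \<omega> \<noteq> \<infinity>"
      by (intro nn_integral_noteq_infinite) auto
    then show ?thesis by (simp add: less_top)
  qed

  have indep_HL: "prob ((H i -` A \<inter> space M) \<inter> ((\<lambda>\<omega> j. l k j \<omega>) -` B \<inter> space M))
        = prob (H i -` A \<inter> space M) * prob ((\<lambda>\<omega> j. l k j \<omega>) -` B \<inter> space M)"
    if "A \<in> sets borel" "B \<in> sets ?P" for i k A B
    using indep_setsD[OF indep, of "{Inl i, Inr k}"
        "case_sum (\<lambda>_. H i -` A \<inter> space M) (\<lambda>_. (\<lambda>\<omega> j. l k j \<omega>) -` B \<inter> space M)"] that
    by (auto simp: E_def)
  define N where "N k i \<omega> = atoms_below (\<lambda>j. l k j \<omega>) (H i \<omega>)" for k i \<omega>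
  note mixed = PP H_meas H_pos H_fin indep_HL
  have N_meas [measurable]: "N k i \<in> M \<rightarrow>\<^sub>M count_space UNIV" if "i \<ge> 1" for k i
    unfolding N_def by (rule atoms_below_meas[OF mixed]) (use that in auto)
  have N_meas' [measurable]: "N k (Suc i) \<in> M \<rightarrow>\<^sub>M count_space UNIV" for k i
    by (rule N_meas) simp
  have N_distr: "distr M borel (\<lambda>\<omega>. g (N k i \<omega>)) = distr M borel (\<lambda>\<omega>. g (N 1 1 \<omega>))"
    if "i \<ge> 1" for g :: "nat \<Rightarrow> real" and k i
  proof -
    have "distr M (count_space UNIV) (N k i) = distr M (count_space UNIV) (N 1 1)"
    proof (rule measure_eqI_countable[of _ UNIV])
      fix t
      have "emeasure (distr M (count_space UNIV) (N k i)) {t}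
          = (\<integral>\<^sup>+y. ennreal (exp (- (\<theta> * enn2real y)) * (\<theta> * enn2real y) ^ t / fact t) \<partial>distr M borel (H 1))"
        if "i \<ge> 1" for k i
      proof -
        have "emeasure (distr M (count_space UNIV) (N k i)) {t} = emeasure M {\<omega>\<in>space M. N k i \<omega> = t}"
          using N_meas[OF that] by (subst emeasure_distr) (auto intro!: arg_cong[where f = "emeasure M"])
        also have "\<dots> = (\<integral>\<^sup>+y. ennreal (exp (- (\<theta> * enn2real y)) * (\<theta> * enn2real y) ^ t / fact t) \<partial>distr M borel (H i))"
          unfolding N_def by (rule emeasure_mixed_poisson[OF mixed]) (use that in auto)
        finally show ?thesis by (simp add: H_id[OF that])
      qed
      from this[OF that, of k] this[of 1 1]
      show "emeasure (distr M (count_space UNIV) (N k i)) {t} = emeasure (distr M (count_space UNIV) (N 1 1)) {t}"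
        by simp
    qed auto
    moreover have "distr M borel (\<lambda>\<omega>. g (N k i \<omega>)) = distr (distr M (count_space UNIV) (N k i)) borel g"
      if "i \<ge> 1" for k i
      using N_meas[OF that] by (subst distr_distr) (auto simp: comp_def)
    ultimately show ?thesis using that by simp
  qed

  have EN: "(\<integral>\<^sup>+\<omega>. ennreal (real (N 1 1 \<omega>)) \<partial>M) = ennreal (\<theta> * m)"
  proof -
    have "(\<integral>\<^sup>+\<omega>. ennreal (real (N 1 1 \<omega>)) \<partial>M) = (\<integral>\<^sup>+\<omega>. ennreal (\<theta> * enn2real (H 1 \<omega>)) \<partial>M)"
      unfolding N_def
      by (rule nn_integral_mixed_poisson[OF mixed, where g = "\<lambda>x. x"])
        (use \<open>\<theta> > 0\<close> sums_poisson_moment1 in auto)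
    also have "\<dots> = (\<integral>\<^sup>+\<omega>. ennreal \<theta> * H 1 \<omega> \<partial>M)"
      using H_fin[of 1] \<open>\<theta> > 0\<close> by (intro nn_integral_cong_AE) (auto simp: ennreal_mult elim!: eventually_mono)
    also have "\<dots> = ennreal (\<theta> * m)"
      using \<open>\<theta> > 0\<close> by (simp add: nn_integral_cmult m[simplified] ennreal_mult' )
    finally show ?thesis .
  qed
  have m_pos: "0 < m"
  proof (rule ccontr)
    assume "\<not> 0 < m"
    then have "(\<integral>\<^sup>+ \<omega>. H 1 \<omega> \<partial>M) = 0" by (simp add: m ennreal_neg)
    then have "AE \<omega> in M. H 1 \<omega> = 0" by (subst (asm) nn_integral_0_iff_AE) auto
    then have "AE \<omega> in M. False"
      using AE_space
    proof eventually_elim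
      case (elim \<omega>)
      then show ?case using H_pos[of 1 \<omega>] by simp
    qed
    then show False by simp
  qed

  define X where "X i \<omega> = real (N (Suc i) (Suc i) \<omega>)" for i \<omega>
  define Y where "Y i \<omega> = real (N 0 (Suc i) \<omega>)" for i \<omega>
  have [measurable]: "random_variable borel (X i)" "random_variable borel (Y i)" for i
    unfolding X_def Y_def by (rule measurable_compose[OF N_meas'], simp)+
  have X_distr: "distr M borel (\<lambda>\<omega>. g (X i \<omega>)) = distr M borel (\<lambda>\<omega>. g (X j \<omega>))"
    and Y_distr: "distr M borel (\<lambda>\<omega>. g (Y i \<omega>)) = distr M borel (\<lambda>\<omega>. g (X j \<omega>))"
    for g :: "real \<Rightarrow> real" and i j
    unfolding X_def Y_def
    by (rule trans[OF N_distr[of _ "\<lambda>n. g (real n)"] N_distr[of _ "\<lambda>n. g (real n)", symmetric]]; simp)+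
  have X0: "integrable M (X 0)" "expectation (X 0) = \<theta> * m"
    using EN \<open>\<theta> > 0\<close> m_pos unfolding X_def One_nat_def[symmetric]
    by (auto intro!: integrableI_nn_integral_finite simp: integral_eq_nn_integral)
  have X_int: "integrable M (X i)" for i
    by (rule integrable_identically_distributed[OF X_distr[of "\<lambda>x. x"] _ _ X0(1)]) auto
  have Y_int: "integrable M (Y i)" for i
    by (rule integrable_identically_distributed[OF Y_distr[of "\<lambda>x. x"] _ _ X0(1)]) auto
  have X_exp: "expectation (X i) = \<theta> * m" for i
  proof -
    have "expectation (X i) = integral\<^sup>L (distr M borel (X i)) (\<lambda>x. x)" for i
      by (subst integral_distr) auto
    then show ?thesis using X0(2) X_distr[of "\<lambda>x. x" i 0] by simp
  qed

  have X_indep: "indep_vars (\<lambda>_. borel) X UNIV"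
    unfolding indep_vars_def2
  proof (intro conjI ballI)
    let ?I = "\<lambda>j. {Inl (Suc j), Inr (Suc j)}"
    have "indep_sets (\<lambda>j. sigma_sets (space M) (\<Union>i\<in>?I j. E i)) UNIV"
    proof (rule indep_sets_collect_sigma)
      show "indep_sets E (\<Union>j\<in>UNIV. ?I j)" using indep by (rule indep_sets_mono_index[rotated]) auto
      show "disjoint_family_on ?I UNIV" by (auto simp: disjoint_family_on_def)
      fix i :: "nat + nat"
      show "Int_stable (E i)"
        by (cases i; simp add: E_def Int_stable_def; safe;
            rule_tac x = "A \<inter> Aa" in exI; auto)
    qed
    then show "indep_sets (\<lambda>i. {X i -` A \<inter> space M | A. A \<in> sets borel}) UNIV"
    proof (rule indep_sets_mono_sets)
      fix i
      let ?F = "\<Union>i\<in>?I i. E i"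
      let ?N = "sigma (space M) ?F"
      have sub: "?F \<subseteq> Pow (space M)" by (auto simp: E_def)
      have H: "H (Suc i) \<in> ?N \<rightarrow>\<^sub>M borel"
        by (rule measurableI) (use sub in \<open>auto simp: E_def intro!: sigma_sets.Basic\<close>)
      have l: "(\<lambda>\<omega> j. l (Suc i) j \<omega>) \<in> ?N \<rightarrow>\<^sub>M ?P"
        by (rule measurableI) (use sub in \<open>auto simp: E_def space_PiM intro!: sigma_sets.Basic\<close>)
      have "N (Suc i) (Suc i) \<in> ?N \<rightarrow>\<^sub>M count_space UNIV"
        using measurable_compose[OF measurable_Pair[OF H l] measurable_atoms_below] by (simp add: N_def[abs_def])
      then have "X i \<in> borel_measurable ?N"
        unfolding X_def by (rule measurable_compose) simp
      then show "{X i -` A \<inter> space M | A. A \<in> sets borel} \<subseteq> sigma_sets (space M) ?F"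
        using sub by (auto dest: measurable_sets)
    qed
  qed measurable

  define R where "R n \<omega> = real (atoms_below (\<lambda>j. l 0 j \<omega>) (Max (insert 0 ((\<lambda>k. H k \<omega>) ` {1..<n}))))" for n \<omega>
  have [measurable]: "(\<lambda>\<omega>. Max (insert 0 ((\<lambda>k. H k \<omega>) ` {1..<n}))) \<in> borel_measurable M" for n
  proof (induction n)
    case (Suc n)
    note [measurable] = Suc
    show ?case
    proof (cases "n \<ge> 1")
      case True
      then have "Max (insert 0 ((\<lambda>k. H k \<omega>) ` {1..<Suc n}))
          = max (H n \<omega>) (Max (insert 0 ((\<lambda>k. H k \<omega>) ` {1..<n})))" for \<omega>
        by (subst Max_insert[symmetric]) (simp_all add: atLeastLessThanSuc insert_commute)
      then show ?thesis by simp
    qed simp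
  qed simp
  have R_meas [measurable]: "random_variable borel (R n)" for n
    unfolding R_def atoms_below_def by measurable
  have R_nonneg: "0 \<le> R n \<omega>" for n \<omega> by (simp add: R_def)
  have R_dom: "\<exists>i\<le>n. R n \<omega> \<le> Y i \<omega>" for n \<omega>
  proof -
    define A where "A = insert 0 ((\<lambda>k. H k \<omega>) ` {1..<n})"
    have "Max A \<in> A" unfolding A_def by (rule Max_in) auto
    then consider "Max A = 0" | k where "k \<in> {1..<n}" "Max A = H k \<omega>"
      by (auto simp: A_def)
    then show ?thesis
    proof cases
      case 1
      then have "R n \<omega> = 0" by (simp add: R_def A_def[symmetric] atoms_below_def)
      then show ?thesis by (auto simp: Y_def)
    next
      case (2 k)
      then have "R n \<omega> = Y (k - 1) \<omega>" by (simp add: R_def A_def[symmetric] Y_def N_def)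
      then show ?thesis using 2 by (intro exI[of _ "k - 1"]) auto
    qed
  qed
  have S_meas [measurable]: "random_variable borel (\<lambda>\<omega>. real (seg_sites H l n \<omega>))" for n
  proof -
    have [measurable]: "(\<lambda>\<omega>. card {(i, j). 1 \<le> i \<and> i \<le> n - 1 \<and> ennreal (l i j \<omega>) < H i \<omega>}) \<in> M \<rightarrow>\<^sub>M count_space UNIV"
      by (rule measurable_card_nat_pairs) simp
    show ?thesis unfolding seg_sites_def by measurable
  qed
  have "AE \<omega> in M. \<forall>i. H (Suc i) \<omega> < \<top>"
    unfolding AE_all_countable by (auto intro: H_fin)
  then have S_eq: "AE \<omega> in M. \<forall>n. real (seg_sites H l n \<omega>) = (\<Sum>i<n - 1. X i \<omega>) + R n \<omega>"
  proof (rule AE_mp, intro AE_I2 impI allI)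
    fix \<omega> n assume \<omega>: "\<omega> \<in> space M" "\<forall>i. H (Suc i) \<omega> < \<top>"
    have "{(i, j). 1 \<le> i \<and> i \<le> n - 1 \<and> ennreal (l i j \<omega>) < H i \<omega>}
        = (SIGMA i:Suc ` {..<n - 1}. {j. ennreal (l i j \<omega>) < H i \<omega>})"
      unfolding image_Suc_lessThan by auto
    also have "card \<dots> = (\<Sum>i\<in>Suc ` {..<n - 1}. N i i \<omega>)"
      unfolding N_def atoms_below_def
      by (rule card_SigmaI) (use \<omega> in \<open>auto intro!: finite_atoms_below l_lim\<close>)
    also have "\<dots> = (\<Sum>i<n - 1. N (Suc i) (Suc i) \<omega>)" by (simp add: sum.reindex)
    finally show "real (seg_sites H l n \<omega>) = (\<Sum>i<n - 1. X i \<omega>) + R n \<omega>"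
      by (simp add: seg_sites_def R_def X_def atoms_below_def)
  qed
  have S_eq': "AE \<omega> in M. \<forall>n. real (seg_sites H l n \<omega>) / real n
      = (\<Sum>i<n. X i \<omega>) / real n + (R n \<omega> / real n - X (n - 1) \<omega> / real n)"
    using S_eq
  proof eventually_elim
    case (elim \<omega>)
    show ?case
    proof
      fix n
      show "real (seg_sites H l n \<omega>) / real n
          = (\<Sum>i<n. X i \<omega>) / real n + (R n \<omega> / real n - X (n - 1) \<omega> / real n)"
        by (cases n) (use elim in \<open>auto simp: add_divide_distrib\<close>)
    qed
  qed

  have XY_lim: "AE \<omega> in M. (\<lambda>n. Z n \<omega> / real n) \<longlonglongrightarrow> 0"
    if Z: "Z = X \<or> Z = Y" for Z
  proof (rule identically_distributed_over_n_tendsto_0)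
    show "random_variable borel (Z i)" "integrable M (Z 0)" "0 \<le> Z i \<omega>" for i \<omega>
      using Z X_int Y_int by (auto simp: X_def Y_def)
    show "distr M borel (Z i) = distr M borel (Z 0)" for i
      using Z X_distr[of "\<lambda>x. x"] Y_distr[of "\<lambda>x. x"] by metis
  qed
  have S_lim: "AE \<omega> in M. (\<lambda>n. real (seg_sites H l n \<omega>) / real n) \<longlonglongrightarrow> \<theta> * m"
  proof -
    have "AE \<omega> in M. (\<lambda>n. (\<Sum>i<n. X i \<omega>) / real n) \<longlonglongrightarrow> expectation (X 0)"
      by (rule strong_law_of_large_numbers[OF X_indep X_distr[of "\<lambda>x. x"] X_int])
    then show ?thesis using XY_lim[of X, simplified] XY_lim[of Y, simplified] S_eq'
    proof eventually_elim
      case (elim \<omega>)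
      have "(\<lambda>n. R n \<omega> / real n) \<longlonglongrightarrow> 0"
        by (rule dominated_by_prefix_over_n_tendsto_0[OF elim(3) R_nonneg R_dom])
      moreover have "(\<lambda>n. X (n - 1) \<omega> / real n) \<longlonglongrightarrow> 0"
      proof (rule dominated_by_prefix_over_n_tendsto_0[OF elim(2)])
        show "\<exists>i\<le>n. X (n - 1) \<omega> \<le> X i \<omega>" for n by (rule exI[of _ "n - 1"]) simp
      qed (simp add: X_def)
      ultimately have "(\<lambda>n. (\<Sum>i<n. X i \<omega>) / real n + (R n \<omega> / real n - X (n - 1) \<omega> / real n)) \<longlonglongrightarrow> \<theta> * m + (0 - 0)"
        using elim(1) unfolding X0(2) by (intro tendsto_intros)
      then show ?case using elim(4) by simp
    qed
  qed

  have R_int: "integrable M (R n)" and R_exp_lim: "(\<lambda>n. expectation (R n) / real n) \<longlonglongrightarrow> 0" for n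
  proof -
    have *: "distr M borel (Y i) = distr M borel (Y 0)" for i
      using Y_distr[of "\<lambda>x. x"] by metis
    show "integrable M (R n)" "(\<lambda>n. expectation (R n) / real n) \<longlonglongrightarrow> 0"
      by (rule expectation_dominated_by_prefix_over_n_tendsto_0[of Y R, OF _ _ * _ R_nonneg Y_int];
          use R_dom in \<open>auto simp: Y_def\<close>)+
  qed
  have S_int: "integrable M (\<lambda>\<omega>. real (seg_sites H l n \<omega>))"
    and S_exp: "expectation (\<lambda>\<omega>. real (seg_sites H l n \<omega>)) = real (n - 1) * (\<theta> * m) + expectation (R n)" for n
  proof -
    have *: "AE \<omega> in M. real (seg_sites H l n \<omega>) = (\<Sum>i<n - 1. X i \<omega>) + R n \<omega>"
      using S_eq by eventually_elim simp
    have int: "integrable M (\<lambda>\<omega>. (\<Sum>i<n - 1. X i \<omega>) + R n \<omega>)" using X_int R_int by auto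
    show "integrable M (\<lambda>\<omega>. real (seg_sites H l n \<omega>))"
      by (subst integrable_cong_AE[OF _ _ *]) (use int in auto)
    have "expectation (\<lambda>\<omega>. real (seg_sites H l n \<omega>)) = expectation (\<lambda>\<omega>. (\<Sum>i<n - 1. X i \<omega>) + R n \<omega>)"
      by (rule integral_cong_AE[OF _ _ *]) auto
    then show "expectation (\<lambda>\<omega>. real (seg_sites H l n \<omega>)) = real (n - 1) * (\<theta> * m) + expectation (R n)"
      using X_int R_int X_exp by simp
  qed
  have S_exp_lim: "(\<lambda>n. expectation (\<lambda>\<omega>. real (seg_sites H l n \<omega>) / real n)) \<longlonglongrightarrow> \<theta> * m"
  proof -
    have "(\<lambda>n. \<theta> * m - \<theta> * m / real n + expectation (R n) / real n) \<longlonglongrightarrow> \<theta> * m - 0 + 0"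
      by (intro tendsto_intros lim_const_over_n R_exp_lim)
    then have "(\<lambda>n. \<theta> * m - \<theta> * m / real n + expectation (R n) / real n) \<longlonglongrightarrow> \<theta> * m" by simp
    moreover have "\<forall>\<^sub>F n in sequentially. \<theta> * m - \<theta> * m / real n + expectation (R n) / real n
        = expectation (\<lambda>\<omega>. real (seg_sites H l n \<omega>) / real n)"
      using eventually_gt_at_top[of 0]
      by eventually_elim (simp add: S_exp field_simps of_nat_diff)
    ultimately show ?thesis by (rule Lim_transform_eventually)
  qed
  have S_L1: "(\<lambda>n. expectation (\<lambda>\<omega>. \<bar>real (seg_sites H l n \<omega>) / real n - \<theta> * m\<bar>)) \<longlonglongrightarrow> 0"
    by (rule scheffe_constant_limit[OF _ _ S_lim S_exp_lim]) (use S_int \<open>\<theta> > 0\<close> m_pos in auto)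

  have CLT: "weak_conv_m (\<lambda>n. distr M borel (\<lambda>\<omega>. sqrt (real n) * (real (seg_sites H l n \<omega>) / real n - \<theta> * m)))
      (density lborel (normal_density 0 (sqrt (\<theta> * m + \<theta>\<^sup>2 * (v - m\<^sup>2)))))"
    if v: "(\<integral>\<^sup>+ \<omega>. (H 1 \<omega>)\<^sup>2 \<partial>M) = ennreal v" and "0 \<le> v" for v
  proof -
    have "(\<integral>\<^sup>+\<omega>. ennreal ((real (N 1 1 \<omega>))\<^sup>2) \<partial>M)
        = (\<integral>\<^sup>+\<omega>. ennreal (\<theta> * enn2real (H 1 \<omega>) + (\<theta> * enn2real (H 1 \<omega>))\<^sup>2) \<partial>M)"
      unfolding N_def
      by (rule nn_integral_mixed_poisson[OF mixed, where f = "\<lambda>t. (real t)\<^sup>2" and g = "\<lambda>x. x + x\<^sup>2"])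
        (use \<open>\<theta> > 0\<close> sums_poisson_moment2 in auto)
    also have "\<dots> = (\<integral>\<^sup>+\<omega>. ennreal \<theta> * H 1 \<omega> + ennreal (\<theta>\<^sup>2) * (H 1 \<omega>)\<^sup>2 \<partial>M)"
    proof (rule nn_integral_cong_AE)
      show "AE \<omega> in M. ennreal (\<theta> * enn2real (H 1 \<omega>) + (\<theta> * enn2real (H 1 \<omega>))\<^sup>2)
          = ennreal \<theta> * H 1 \<omega> + ennreal (\<theta>\<^sup>2) * (H 1 \<omega>)\<^sup>2"
        using H_fin[of 1, simplified]
      proof eventually_elim
        case (elim \<omega>)
        then obtain r where "0 \<le> r" "H 1 \<omega> = ennreal r" by (cases "H 1 \<omega>") auto
        then show ?case using \<open>\<theta> > 0\<close>
          by (simp add: ennreal_plus ennreal_mult power_mult_distrib ennreal_power)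
      qed
    qed
    also have "\<dots> = ennreal (\<theta> * m + \<theta>\<^sup>2 * v)"
      using \<open>\<theta> > 0\<close> m_pos \<open>0 \<le> v\<close> m v
      by (simp add: nn_integral_add nn_integral_cmult ennreal_mult ennreal_plus)
    finally have EN2: "(\<integral>\<^sup>+\<omega>. ennreal ((real (N 1 1 \<omega>))\<^sup>2) \<partial>M) = ennreal (\<theta> * m + \<theta>\<^sup>2 * v)" .
    have X0_sq: "integrable M (\<lambda>\<omega>. (X 0 \<omega>)\<^sup>2)" "expectation (\<lambda>\<omega>. (X 0 \<omega>)\<^sup>2) = \<theta> * m + \<theta>\<^sup>2 * v"
      using EN2 \<open>\<theta> > 0\<close> m_pos \<open>0 \<le> v\<close> unfolding X_def One_nat_def[symmetric]
      by (auto intro!: integrableI_nn_integral_finite simp: integral_eq_nn_integral simp del: ennreal_plus)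
    have X_sq: "integrable M (\<lambda>\<omega>. (X i \<omega>)\<^sup>2)" for i
      by (rule integrable_identically_distributed[OF X_distr[of "\<lambda>x. x\<^sup>2"] _ _ X0_sq(1)]) auto
    have Y_sq: "integrable M (\<lambda>\<omega>. (Y i \<omega>)\<^sup>2)" for i
      by (rule integrable_identically_distributed[OF Y_distr[of "\<lambda>x. x\<^sup>2"] _ _ X0_sq(1)]) auto
    have X_sq_exp: "expectation (\<lambda>\<omega>. (X i \<omega>)\<^sup>2) = \<theta> * m + \<theta>\<^sup>2 * v" for i
    proof -
      have "expectation (\<lambda>\<omega>. (X i \<omega>)\<^sup>2) = integral\<^sup>L (distr M borel (\<lambda>\<omega>. (X i \<omega>)\<^sup>2)) (\<lambda>x. x)" for i
        by (subst integral_distr) auto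
      then show ?thesis using X0_sq(2) X_distr[of "\<lambda>x. x\<^sup>2" i 0] by simp
    qed
    define \<sigma> where "\<sigma> = sqrt (\<theta> * m + \<theta>\<^sup>2 * (v - m\<^sup>2))"
    have "m\<^sup>2 \<le> v"
    proof -
      have int: "integrable M (\<lambda>\<omega>. enn2real (H 1 \<omega>))" "integrable M (\<lambda>\<omega>. (enn2real (H 1 \<omega>))\<^sup>2)"
        and eq: "expectation (\<lambda>\<omega>. enn2real (H 1 \<omega>)) = m" "expectation (\<lambda>\<omega>. (enn2real (H 1 \<omega>))\<^sup>2) = v"
      proof -
        have "(\<integral>\<^sup>+\<omega>. ennreal (enn2real (H 1 \<omega>)) \<partial>M) = ennreal m"
          unfolding m[symmetric] using H_fin[of 1] by (intro nn_integral_cong_AE) (auto elim!: eventually_mono)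
        moreover have "(\<integral>\<^sup>+\<omega>. ennreal ((enn2real (H 1 \<omega>))\<^sup>2) \<partial>M) = ennreal v"
          unfolding v[symmetric] using H_fin[of 1]
          by (intro nn_integral_cong_AE) (auto simp: ennreal_power[symmetric] elim!: eventually_mono)
        ultimately show "integrable M (\<lambda>\<omega>. enn2real (H 1 \<omega>))" "integrable M (\<lambda>\<omega>. (enn2real (H 1 \<omega>))\<^sup>2)"
          "expectation (\<lambda>\<omega>. enn2real (H 1 \<omega>)) = m" "expectation (\<lambda>\<omega>. (enn2real (H 1 \<omega>))\<^sup>2) = v"
          using m_pos \<open>0 \<le> v\<close>
          by (auto intro!: integrableI_nn_integral_finite simp: integral_eq_nn_integral)
      qed
      have "0 \<le> variance (\<lambda>\<omega>. enn2real (H 1 \<omega>))" by (rule variance_positive)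
      then show ?thesis using variance_eq[OF int] unfolding eq by linarith
    qed
    then have var_pos: "0 < \<theta> * m + \<theta>\<^sup>2 * (v - m\<^sup>2)"
      using \<open>\<theta> > 0\<close> m_pos by (intro add_pos_nonneg mult_pos_pos mult_nonneg_nonneg) auto
    then have \<sigma>: "0 < \<sigma>" "\<sigma>\<^sup>2 = \<theta> * m + \<theta>\<^sup>2 * (v - m\<^sup>2)" by (auto simp: \<sigma>_def)
    have X_var: "variance (X i) = \<sigma>\<^sup>2" for i
      using variance_eq[OF X_int X_sq, of i] unfolding X_exp X_sq_exp \<sigma>(2)
      by (simp add: right_diff_distrib power_mult_distrib)

    define Z where "Z n \<omega> = (\<Sum>i<n. X i \<omega> - \<theta> * m) / sqrt (real n * \<sigma>\<^sup>2)" for n \<omega>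
    define B where "B n \<omega> = R n \<omega> / sqrt (real n) - X (n - 1) \<omega> / sqrt (real n)" for n \<omega>
    have [measurable]: "random_variable borel (Z n)" "random_variable borel (B n)" for n
      unfolding Z_def B_def by measurable
    have "weak_conv_m (\<lambda>n. distr M borel (Z n)) std_normal_distribution"
      unfolding Z_def
      by (rule central_limit_theorem[OF X_indep X_exp \<sigma>(1) X_sq X_var X_distr[of "\<lambda>x. x" _ 0]])
    then have conv: "weak_conv_m (\<lambda>n. distr M borel (\<lambda>\<omega>. \<sigma> * Z n \<omega>)) (density lborel (normal_density 0 \<sigma>))"
      by (intro weak_conv_m_scale_normal \<sigma>) auto
    have sq_lim: "AE \<omega> in M. (\<lambda>n. (V n \<omega>)\<^sup>2 / real n) \<longlonglongrightarrow> 0"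
      if V: "V = X \<or> V = Y" for V
    proof (rule identically_distributed_over_n_tendsto_0)
      show "random_variable borel (\<lambda>\<omega>. (V i \<omega>)\<^sup>2)" "integrable M (\<lambda>\<omega>. (V 0 \<omega>)\<^sup>2)" "0 \<le> (V i \<omega>)\<^sup>2" for i \<omega>
        using V X_sq Y_sq by auto
      show "distr M borel (\<lambda>\<omega>. (V i \<omega>)\<^sup>2) = distr M borel (\<lambda>\<omega>. (V 0 \<omega>)\<^sup>2)" for i
        using V X_distr[of "\<lambda>x. x\<^sup>2"] Y_distr[of "\<lambda>x. x\<^sup>2"] by metis
    qed
    have B_lim: "AE \<omega> in M. (\<lambda>n. B n \<omega>) \<longlonglongrightarrow> 0"
      using sq_lim[of X, simplified] sq_lim[of Y, simplified]
    proof eventually_elim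
      case (elim \<omega>)
      have "(\<lambda>n. R n \<omega> / sqrt (real n)) \<longlonglongrightarrow> 0"
      proof (rule tendsto_sqrt_of_square_over_n[OF dominated_by_prefix_over_n_tendsto_0[OF elim(2)]])
        fix n
        from R_dom[of n \<omega>] obtain i where "i \<le> n" "R n \<omega> \<le> Y i \<omega>" by blast
        then show "\<exists>i\<le>n. (R n \<omega>)\<^sup>2 \<le> (Y i \<omega>)\<^sup>2" using R_nonneg by (auto intro!: exI[of _ i] power_mono)
      qed (use R_nonneg in auto)
      moreover have "(\<lambda>n. X (n - 1) \<omega> / sqrt (real n)) \<longlonglongrightarrow> 0"
      proof (rule tendsto_sqrt_of_square_over_n[OF dominated_by_prefix_over_n_tendsto_0[OF elim(1)]])
        show "\<exists>i\<le>n. (X (n - 1) \<omega>)\<^sup>2 \<le> (X i \<omega>)\<^sup>2" for n by (rule exI[of _ "n - 1"]) simp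
      qed (auto simp: X_def)
      ultimately have "(\<lambda>n. B n \<omega>) \<longlonglongrightarrow> 0 - 0" unfolding B_def by (rule tendsto_diff)
      then show ?case by simp
    qed
    have "weak_conv_m (\<lambda>n. distr M borel (\<lambda>\<omega>. \<sigma> * Z n \<omega> + B n \<omega>)) (density lborel (normal_density 0 \<sigma>))"
      by (rule slutsky_add_null_sequence[OF _ _ conv real_distribution_normal[OF \<sigma>(1)] B_lim]) auto
    moreover have "distr M borel (\<lambda>\<omega>. \<sigma> * Z n \<omega> + B n \<omega>)
        = distr M borel (\<lambda>\<omega>. sqrt (real n) * (real (seg_sites H l n \<omega>) / real n - \<theta> * m))" for n
    proof (rule distr_cong_AE)
      show "AE \<omega> in M. \<sigma> * Z n \<omega> + B n \<omega> = sqrt (real n) * (real (seg_sites H l n \<omega>) / real n - \<theta> * m)"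
        using S_eq'
      proof eventually_elim
        case (elim \<omega>)
        show ?case
        proof (cases "n = 0")
          case True
          then show ?thesis by (simp add: Z_def B_def)
        next
          case False
          have sq: "sqrt (real n) * (a / real n) = a / sqrt (real n)" for a
            using False by (simp add: field_simps flip: power2_eq_square)
          have "\<sigma> * Z n \<omega> = ((\<Sum>i<n. X i \<omega>) - real n * (\<theta> * m)) / sqrt (real n)"
            using \<sigma>(1) by (simp add: Z_def real_sqrt_mult sum_subtractf)
          also have "\<dots> = sqrt (real n) * (((\<Sum>i<n. X i \<omega>) - real n * (\<theta> * m)) / real n)"
            by (rule sq[symmetric])
          also have "\<dots> = sqrt (real n) * ((\<Sum>i<n. X i \<omega>) / real n - \<theta> * m)"
            using False by (simp add: diff_divide_distrib)
          finally have 1: "\<sigma> * Z n \<omega> = sqrt (real n) * ((\<Sum>i<n. X i \<omega>) / real n - \<theta> * m)" .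
          have 2: "B n \<omega> = sqrt (real n) * (R n \<omega> / real n - X (n - 1) \<omega> / real n)"
            unfolding B_def right_diff_distrib sq ..
          show ?thesis
            unfolding 1 2 distrib_left[symmetric] elim[rule_format, of n] by (simp add: add_diff_eq)
        qed
      qed
    qed auto
    ultimately show ?thesis by (simp add: \<sigma>_def)
  qed
  show ?thesis
    unfolding m_def[symmetric]
  proof (intro conjI impI allI S_lim S_int S_L1)
    assume fin: "(\<integral>\<^sup>+ \<omega>. (H 1 \<omega>)\<^sup>2 \<partial>M) < \<infinity>"
    then have "(\<integral>\<^sup>+ \<omega>. (H 1 \<omega>)\<^sup>2 \<partial>M) = ennreal (enn2real (\<integral>\<^sup>+ \<omega>. (H 1 \<omega>)\<^sup>2 \<partial>M))" by simp
    then show "weak_conv_m (\<lambda>n. distr M borel (\<lambda>\<omega>. sqrt (real n) * (real (seg_sites H l n \<omega>) / real n - \<theta> * m)))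
        (density lborel (normal_density 0 (sqrt (\<theta> * m
          + \<theta>\<^sup>2 * (enn2real (\<integral>\<^sup>+ \<omega>. (H 1 \<omega>)\<^sup>2 \<partial>M) - m\<^sup>2)))))"
      by (rule CLT) simp
  qed
qed

end
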